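(* Let $\{X(s)\}_{s\ge 0}$ be a centered Gaussian process with continuous sample paths and covariance kernel $R(s,t)=\mathbb{E}[X(s)X(t)]$. Assume: (i) there exists $\rho>0$ such that $R(cs,ct)=c^{2\rho}R(s,t)$ for all $c>0$ and all $s,t>0$; (ii) there exists $\eta>0$ such that the function $h(x)=x^{-\rho}R(1,x)$, $x\ge 1$, satisfies $h(x)=O((\log x)^{-\eta})$ as $x\to\infty$. Then \[ \limsup_{s\to\infty}\pm\frac{X(s)}{\sqrt{2s^{2\rho}\log\log s}}=R(1,1)^{1/2}\quad\text{almost surely} \] (for both choices of sign). *)

theory Defs
  imports "HOL-Probability.Probability" "HOL-Library.Landau_Symbols"
begin

definition centered_gaussian_rv :: "'a measure \<Rightarrow> ('a \<Rightarrow> real) \<Rightarrow> bool" where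
  "centered_gaussian_rv M Y \<longleftrightarrow>
     Y \<in> borel_measurable M \<and>
     ((AE \<omega> in M. Y \<omega> = 0) \<or> (\<exists>\<sigma>>0. distributed M lborel Y (normal_density 0 \<sigma>)))"

definition centered_gaussian_process :: "'a measure \<Rightarrow> (real \<Rightarrow> 'a \<Rightarrow> real) \<Rightarrow> bool" where
  "centered_gaussian_process M X \<longleftrightarrow>
     prob_space M \<and>
     (\<forall>I c. finite I \<longrightarrow> I \<subseteq> {0..} \<longrightarrow>
        centered_gaussian_rv M (\<lambda>\<omega>. \<Sum>t\<in>I. c t * X t \<omega>))"

end

theory Submission
  imports Defs "HOL-Real_Asymp.Real_Asymp"
begin

text \<open>
  The process \<open>Y u = exp (- \<rho> * u) * X (exp u)\<close> is stationary, its covariance \<open>r\<close> decays polynomially,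
  and the claim becomes \<open>Limsup (Y u / sqrt (2 * ln u)) = sqrt (r 0)\<close> as \<open>u\<close> tends to infinity.

  Upper bound: on a grid of mesh \<open>\<delta>\<close> the Gaussian tail and the first Borel-Cantelli lemma suffice. The
  oscillation of \<open>Y\<close> between grid points is below \<open>s\<close> with probability at least 3/4 once \<open>\<delta>\<close> is
  small, by continuity of paths alone; Fernique's inequality turns this into a Gaussian tail whose
  exponent is as large as desired when \<open>s\<close> is small.

  Lower bound: among the points \<open>j * n powr e\<close>, \<open>1 \<le> j \<le> n = 2 ^ k\<close>, the covariances are at most
  \<open>n powr - (e * \<eta>)\<close> up to a constant. The sum of exponentially tilted indicators of
  \<open>Y u \<approx> sqrt (2 * (1 - 4 * e) * r 0 * ln n)\<close> has relative variance summable in \<open>k\<close>, so by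
  Chebyshev's inequality and again the first Borel-Cantelli lemma some point of all but
  finitely many of these grids is that high. No independence or zero-one law is needed.
\<close>

text \<open>No modulus of continuity of the covariance is assumed from which a chaining bound could
  start. Fernique's inequality fits because it turns a single probability bound into a Gaussian
  tail. Its price is equality of joint laws of infinitely many coordinates, for shifts of
  \<open>Y\<close> and for the rotation by 45 degrees of two independent copies. Gaussian processes
  being given through linear combinations alone, such equalities are derived from cosine integrals
  of finite combinations.

  The constants of the lower bound balance errors that must all be negative powers of
  \<open>n\<close>, since these are summable along \<open>n = 2 ^ k\<close>. The spacing
  \<open>n powr e\<close> makes covariances so small that they beat the factor
  \<open>\<tau>\<^sup>2\<close>, of order \<open>ln n\<close>, in the exponent; it costs a factor
  \<open>1 + e\<close> in \<open>ln u\<close>. The diagonal of the second moment has relative size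
  \<open>n powr ((1 + 2 * e) * (1 - 4 * e) - 1)\<close>; the loss \<open>4 * e\<close> in the level
  makes this exponent negative. As \<open>e\<close> is arbitrary, neither loss affects the
  limit.\<close>

section \<open>Laws determined by linear combinations\<close>

text \<open>Both weights have the same total mass \<open>c\<close>, and dividing by it gives two
  probability measures. Phases 0 and \<open>- (pi/2)\<close> in the hypothesis are the real and
  imaginary parts of the characteristic functions of \<open>X\<close> and \<open>Y\<close> under
  them, so Levy's uniqueness theorem applies. The lower bound 1 keeps \<open>c\<close> positive, the
  upper bound \<open>B\<close> gives integrability.\<close>

lemma weighted_law_eqI:
  fixes X V :: "'a \<Rightarrow> real" and Y W :: "'b \<Rightarrow> real"
  assumes "prob_space M" "prob_space N"
    and [measurable]: "X \<in> borel_measurable M" "Y \<in> borel_measurable N"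
      "V \<in> borel_measurable M" "W \<in> borel_measurable N"
    and V: "\<And>\<omega>. 1 \<le> V \<omega> \<and> V \<omega> \<le> B" and W: "\<And>\<omega>. 1 \<le> W \<omega> \<and> W \<omega> \<le> B"
    and eq: "\<And>\<theta> \<tau>. (\<integral>\<omega>. V \<omega> * cos (\<theta> + \<tau> * X \<omega>) \<partial>M) = (\<integral>\<omega>. W \<omega> * cos (\<theta> + \<tau> * Y \<omega>) \<partial>N)"
    and [measurable]: "A \<in> sets borel"
  shows "(\<integral>\<omega>. V \<omega> * indicator A (X \<omega>) \<partial>M) = (\<integral>\<omega>. W \<omega> * indicator A (Y \<omega>) \<partial>N)"
proof -
  define c where "c = (\<integral>\<omega>. V \<omega> \<partial>M)"
  have c_W: "c = (\<integral>\<omega>. W \<omega> \<partial>N)"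
    using eq[of 0 0] by (simp add: c_def)
  \<comment> \<open>Stated for an arbitrary space, since it is instantiated on both sides and these
    have different types.\<close>
  have main: "c \<ge> 1 \<and> real_distribution (distr (density K (\<lambda>\<omega>. U \<omega> / c)) borel Z)
      \<and> char (distr (density K (\<lambda>\<omega>. U \<omega> / c)) borel Z) \<tau> =
        Complex ((\<integral>\<omega>. U \<omega> * cos (0 + \<tau> * Z \<omega>) \<partial>K) / c) ((\<integral>\<omega>. U \<omega> * cos (- (pi/2) + \<tau> * Z \<omega>) \<partial>K) / c)
      \<and> (\<integral>\<omega>. U \<omega> * indicator A (Z \<omega>) \<partial>K) = c * measure (distr (density K (\<lambda>\<omega>. U \<omega> / c)) borel Z) A"
    if K: "prob_space K" and [measurable]: "U \<in> borel_measurable K" "Z \<in> borel_measurable K"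
      and U: "\<And>\<omega>. 1 \<le> U \<omega> \<and> U \<omega> \<le> B" and c: "c = (\<integral>\<omega>. U \<omega> \<partial>K)"
    for K :: "'c measure" and U Z \<tau>
  proof -
    interpret K: prob_space K by fact
    have intU: "integrable K U"
    proof (intro K.integrable_const_bound[of _ B] AE_I2)
      show "norm (U \<omega>) \<le> B" for \<omega> using U[of \<omega>] by simp
    qed simp
    have "(\<integral>\<omega>. 1 \<partial>K) \<le> (\<integral>\<omega>. U \<omega> \<partial>K)"
      using U by (intro integral_mono intU) auto
    then have c1: "c \<ge> 1"
      using c by (simp add: K.prob_space)
    have pos: "AE \<omega> in K. 0 \<le> U \<omega> / c"
      using c1 U by (auto intro!: AE_I2 divide_nonneg_nonneg intro: order_trans[OF zero_le_one])
    let ?D = "density K (\<lambda>\<omega>. U \<omega> / c)"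
    have "emeasure ?D (space ?D) = (\<integral>\<^sup>+\<omega>. ennreal (U \<omega> / c) \<partial>K)"
      by (subst emeasure_density) (auto intro!: nn_integral_cong)
    also have "\<dots> = ennreal (\<integral>\<omega>. U \<omega> / c \<partial>K)"
      using intU pos by (intro nn_integral_eq_integral) auto
    also have "\<dots> = 1" using c c1 by simp
    finally interpret D: prob_space ?D by (rule prob_spaceI)
    have dist: "real_distribution (distr ?D borel Z)"
      by (rule D.real_distribution_distr) simp
    have bnd: "integrable K (\<lambda>\<omega>. U \<omega> * cos (t + \<tau> * Z \<omega>))" for t
      by (intro Bochner_Integration.integrable_bound[OF intU])
        (auto intro!: AE_I2 simp: abs_mult mult_left_le)
    have pt: "(U \<omega> / c) *\<^sub>R iexp (\<tau> * Z \<omega>) =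
        complex_of_real (U \<omega> * cos (0 + \<tau> * Z \<omega>) / c) + \<i> * complex_of_real (U \<omega> * cos (- (pi/2) + \<tau> * Z \<omega>) / c)" for \<omega>
    proof -
      have "iexp (\<tau> * Z \<omega>) = cis (\<tau> * Z \<omega>)" by (simp only: cis_conv_exp)
      then show ?thesis by (simp add: complex_eq_iff cos_add cos_diff del: of_real_mult)
    qed
    have "char (distr ?D borel Z) \<tau> = (\<integral>\<omega>. (U \<omega> / c) *\<^sub>R iexp (\<tau> * Z \<omega>) \<partial>K)"
      unfolding char_def using pos
      by (subst integral_distr) (auto simp: integral_density)
    also have "\<dots> = complex_of_real (\<integral>\<omega>. U \<omega> * cos (0 + \<tau> * Z \<omega>) / c \<partial>K) +
        \<i> * complex_of_real (\<integral>\<omega>. U \<omega> * cos (- (pi/2) + \<tau> * Z \<omega>) / c \<partial>K)"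
      unfolding pt using bnd[of 0] bnd[of "- (pi/2)"]
      by (subst Bochner_Integration.integral_add) (auto intro!: integrable_of_real integrable_mult_right integrable_divide simp del: of_real_mult of_real_divide)
    finally have ch: "char (distr ?D borel Z) \<tau> = Complex ((\<integral>\<omega>. U \<omega> * cos (0 + \<tau> * Z \<omega>) \<partial>K) / c)
        ((\<integral>\<omega>. U \<omega> * cos (- (pi/2) + \<tau> * Z \<omega>) \<partial>K) / c)"
      by (simp add: complex_eq_iff)
    have "measure (distr ?D borel Z) A = (\<integral>x. indicator A x \<partial>distr ?D borel Z)"
      by simp
    also have "\<dots> = (\<integral>\<omega>. (U \<omega> / c) * indicator A (Z \<omega>) \<partial>K)"
      using pos by (subst integral_distr) (auto simp: integral_density)
    also have "\<dots> = (\<integral>\<omega>. U \<omega> * indicator A (Z \<omega>) \<partial>K) / c"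
      by simp
    finally show ?thesis using c1 dist ch by simp
  qed
  note M = main[OF \<open>prob_space M\<close> _ _ V c_def, of X]
  note N = main[OF \<open>prob_space N\<close> _ _ W c_W, of Y]
  have "distr (density M (\<lambda>\<omega>. V \<omega> / c)) borel X = distr (density N (\<lambda>\<omega>. W \<omega> / c)) borel Y"
  proof (rule Levy_uniqueness)
    show "char (distr (density M (\<lambda>\<omega>. V \<omega> / c)) borel X) = char (distr (density N (\<lambda>\<omega>. W \<omega> / c)) borel Y)"
    proof
      fix \<tau>
      show "char (distr (density M (\<lambda>\<omega>. V \<omega> / c)) borel X) \<tau> = char (distr (density N (\<lambda>\<omega>. W \<omega> / c)) borel Y) \<tau>"
        using M[of \<tau>] N[of \<tau>] eq[of 0 \<tau>] eq[of "- (pi/2)" \<tau>] by simp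
    qed
  qed (use M N in auto)
  then show ?thesis using M N by simp
qed

text \<open>The cosine test function is traded for indicators one coordinate at a time. The phase
  \<open>\<theta>\<close> makes the class of test functions closed under multiplication by cosines of a further
  coordinate, and adding 2 to the weight makes it positive, so that uniqueness of characteristic
  functions of probability measures on the line applies.\<close>

lemma cylinder_weighted_eqI:
  fixes X :: "'i \<Rightarrow> 'a \<Rightarrow> real" and Y :: "'i \<Rightarrow> 'b \<Rightarrow> real"
  assumes "prob_space M" "prob_space N" "finite I"
    and [measurable]: "\<And>i. i \<in> I \<Longrightarrow> X i \<in> borel_measurable M" "\<And>i. i \<in> I \<Longrightarrow> Y i \<in> borel_measurable N"
    and eq: "\<And>\<theta> c. (\<integral>\<omega>. cos (\<theta> + (\<Sum>i\<in>I. c i * X i \<omega>)) \<partial>M) = (\<integral>\<omega>. cos (\<theta> + (\<Sum>i\<in>I. c i * Y i \<omega>)) \<partial>N)"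
    and A: "\<And>i. i \<in> I \<Longrightarrow> A i \<in> sets borel"
    and K: "K \<subseteq> I"
  shows "(\<integral>\<omega>. (\<Prod>k\<in>K. indicator (A k) (X k \<omega>)) * cos (\<theta> + (\<Sum>i\<in>I. c i * X i \<omega>)) \<partial>M) =
         (\<integral>\<omega>. (\<Prod>k\<in>K. indicator (A k) (Y k \<omega>)) * cos (\<theta> + (\<Sum>i\<in>I. c i * Y i \<omega>)) \<partial>N)"
  using finite_subset[OF K \<open>finite I\<close>] K
proof (induction K arbitrary: \<theta> c rule: finite_induct)
  case empty
  then show ?case using eq by simp
next
  case (insert k K)
  interpret M: prob_space M by fact
  interpret N: prob_space N by fact
  have k: "k \<in> I" and KI: "K \<subseteq> I" using insert by auto
  have [measurable]: "X k \<in> borel_measurable M" "Y k \<in> borel_measurable N" "A k \<in> sets borel"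
    using k A by auto
  have [measurable]: "A i \<in> sets borel" if "i \<in> K" for i using that KI A by auto
  have [measurable]: "X i \<in> borel_measurable M" "Y i \<in> borel_measurable N" if "i \<in> K" for i
    using that KI by auto
  define V where "V \<omega> = (\<Prod>k\<in>K. indicator (A k) (X k \<omega>)) * cos (\<theta> + (\<Sum>i\<in>I. c i * X i \<omega>))" for \<omega>
  define W where "W \<omega> = (\<Prod>k\<in>K. indicator (A k) (Y k \<omega>)) * cos (\<theta> + (\<Sum>i\<in>I. c i * Y i \<omega>))" for \<omega>
  have [measurable]: "V \<in> borel_measurable M" "W \<in> borel_measurable N"
    unfolding V_def W_def by measurable
  have prod01: "\<bar>\<Prod>k\<in>K. indicator (A k) (f k)\<bar> \<le> (1::real)" for f
    unfolding abs_prod by (intro prod_le_1) (auto simp: indicator_def)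
  have V1: "\<bar>V \<omega>\<bar> \<le> 1" and W1: "\<bar>W \<omega>'\<bar> \<le> 1" for \<omega> \<omega>'
    unfolding V_def W_def abs_mult by (intro mult_le_one prod01 abs_cos_le_one abs_ge_zero)+
  let ?d = "\<lambda>d j i. if i = j then d else (0::real)"
  have single: "(\<Sum>i\<in>I. ?d d k i * f i) = d * f k" for d and f :: "'i \<Rightarrow> real"
    using k \<open>finite I\<close> by (simp add: if_distrib[of "\<lambda>x. x * _"] cong: if_cong)
  have eq1: "(\<integral>\<omega>. cos (t + d * X k \<omega>) \<partial>M) = (\<integral>\<omega>. cos (t + d * Y k \<omega>) \<partial>N)" for t d
    using eq[of t "?d d k"] by (simp add: single)
  \<comment> \<open>Product-to-sum formula: the new cosine only changes the phase and the
    coefficient of coordinate \<open>k\<close>, so both summands are covered by the induction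
    hypothesis.\<close>
  have expand: "(P * cos (\<theta> + (\<Sum>i\<in>I. c i * f i))) * cos (t + d * f k) =
     (P * cos ((\<theta> - t) + (\<Sum>i\<in>I. (c i - ?d d k i) * f i)) + P * cos ((\<theta> + t) + (\<Sum>i\<in>I. (c i + ?d d k i) * f i))) / 2"
    for P t d f
  proof -
    have "(\<Sum>i\<in>I. (c i - ?d d k i) * f i) = (\<Sum>i\<in>I. c i * f i) - d * f k"
      "(\<Sum>i\<in>I. (c i + ?d d k i) * f i) = (\<Sum>i\<in>I. c i * f i) + d * f k"
      by (simp_all only: left_diff_distrib distrib_right sum_subtractf sum.distrib single)
    moreover have "cos (a + s) * cos (t + x) = (cos ((a - t) + (s - x)) + cos ((a + t) + (s + x))) / 2" for a s x :: real
      unfolding cos_times_cos by (simp add: algebra_simps)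
    ultimately show ?thesis
      by (simp only: mult.assoc) (simp only: distrib_left[symmetric] times_divide_eq_right)
  qed
  have intM: "integrable M (\<lambda>\<omega>. (\<Prod>k\<in>K. indicator (A k) (X k \<omega>)) * cos (t + (\<Sum>i\<in>I. b i * X i \<omega>)))" for t b
    by (intro M.integrable_const_bound[of _ 1])
      (auto intro!: AE_I2 mult_le_one prod01 simp: abs_mult)
  have intN: "integrable N (\<lambda>\<omega>. (\<Prod>k\<in>K. indicator (A k) (Y k \<omega>)) * cos (t + (\<Sum>i\<in>I. b i * Y i \<omega>)))" for t b
    by (intro N.integrable_const_bound[of _ 1])
      (auto intro!: AE_I2 mult_le_one prod01 simp: abs_mult)
  have eqVW: "(\<integral>\<omega>. V \<omega> * cos (t + d * X k \<omega>) \<partial>M) = (\<integral>\<omega>. W \<omega> * cos (t + d * Y k \<omega>) \<partial>N)" for t d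
    unfolding V_def W_def expand[of _ "\<lambda>i. X i \<omega>" for \<omega>] expand[of _ "\<lambda>i. Y i \<omega>" for \<omega>] using insert.IH[OF KI]
    by (simp add: Bochner_Integration.integral_add[OF intM intM] Bochner_Integration.integral_add[OF intN intN])
  have intMc: "integrable M (\<lambda>\<omega>. cos (t + d * X k \<omega>))" "integrable M (\<lambda>\<omega>. V \<omega> * cos (t + d * X k \<omega>))" for t d
    by (intro M.integrable_const_bound[of _ 1]; auto intro!: AE_I2 mult_le_one V1 simp: abs_mult)+
  have intNc: "integrable N (\<lambda>\<omega>. cos (t + d * Y k \<omega>))" "integrable N (\<lambda>\<omega>. W \<omega> * cos (t + d * Y k \<omega>))" for t d
    by (intro N.integrable_const_bound[of _ 1]; auto intro!: AE_I2 mult_le_one W1 simp: abs_mult)+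
  have "(\<integral>\<omega>. (V \<omega> + 2) * indicator (A k) (X k \<omega>) \<partial>M) = (\<integral>\<omega>. (W \<omega> + 2) * indicator (A k) (Y k \<omega>) \<partial>N)"
  proof (rule weighted_law_eqI[where B = 3])
    show "1 \<le> V \<omega> + 2 \<and> V \<omega> + 2 \<le> 3" for \<omega> using V1[of \<omega>] by linarith
    show "1 \<le> W \<omega> + 2 \<and> W \<omega> + 2 \<le> 3" for \<omega> using W1[of \<omega>] by linarith
    show "(\<integral>\<omega>. (V \<omega> + 2) * cos (t + d * X k \<omega>) \<partial>M) = (\<integral>\<omega>. (W \<omega> + 2) * cos (t + d * Y k \<omega>) \<partial>N)" for t d
      unfolding distrib_right using intMc intNc eqVW eq1 by simp
  qed (use assms in auto)
  \<comment> \<open>The same lemma with constant weight 1 removes the contribution of the added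
    2.\<close>
  moreover have "(\<integral>\<omega>. 1 * indicat_real (A k) (X k \<omega>) \<partial>M) = (\<integral>\<omega>. 1 * indicator (A k) (Y k \<omega>) \<partial>N)"
    by (rule weighted_law_eqI[where B = 1]) (use assms eq1 in auto)
  moreover have "integrable M (\<lambda>\<omega>. V \<omega> * indicator (A k) (X k \<omega>))" "integrable M (\<lambda>\<omega>. indicator (A k) (X k \<omega>) :: real)"
    using V1 by (auto intro!: M.integrable_const_bound[of _ 1] AE_I2 simp: indicator_def)
  moreover have "integrable N (\<lambda>\<omega>. W \<omega> * indicator (A k) (Y k \<omega>))" "integrable N (\<lambda>\<omega>. indicator (A k) (Y k \<omega>) :: real)"
    using W1 by (auto intro!: N.integrable_const_bound[of _ 1] AE_I2 simp: indicator_def)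
  ultimately have "(\<integral>\<omega>. V \<omega> * indicator (A k) (X k \<omega>) \<partial>M) = (\<integral>\<omega>. W \<omega> * indicator (A k) (Y k \<omega>) \<partial>N)"
    by (simp add: distrib_right)
  then show ?case
    using insert.hyps by (simp add: V_def W_def mult_ac)
qed

text \<open>Finite-dimensional cylinders determine a finite measure on the product. Their masses are
  the integrals of \<open>cylinder_weighted_eqI\<close> with phase and coefficients 0, where the
  cosine factor is 1; \<open>cyl\<close> keeps this factor to match that form.\<close>

lemma distr_PiM_eqI_cos:
  fixes X :: "'i \<Rightarrow> 'a \<Rightarrow> real" and Y :: "'i \<Rightarrow> 'b \<Rightarrow> real"
  assumes "prob_space M" "prob_space N"
    and meas [measurable]: "\<And>i. i \<in> I \<Longrightarrow> X i \<in> borel_measurable M" "\<And>i. i \<in> I \<Longrightarrow> Y i \<in> borel_measurable N"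
    and eq: "\<And>J \<theta> c. finite J \<Longrightarrow> J \<subseteq> I \<Longrightarrow>
      (\<integral>\<omega>. cos (\<theta> + (\<Sum>i\<in>J. c i * X i \<omega>)) \<partial>M) = (\<integral>\<omega>. cos (\<theta> + (\<Sum>i\<in>J. c i * Y i \<omega>)) \<partial>N)"
  shows "distr M (Pi\<^sub>M I (\<lambda>_. borel)) (\<lambda>\<omega>. \<lambda>i\<in>I. X i \<omega>) = distr N (Pi\<^sub>M I (\<lambda>_. borel)) (\<lambda>\<omega>. \<lambda>i\<in>I. Y i \<omega>)"
proof -
  interpret M: prob_space M by fact
  interpret N: prob_space N by fact
  interpret dM: prob_space "distr M (Pi\<^sub>M I (\<lambda>_. borel)) (\<lambda>\<omega>. \<lambda>i\<in>I. X i \<omega>)"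
    by (rule M.prob_space_distr) simp
  have cyl: "emeasure (distr K (Pi\<^sub>M I (\<lambda>_. borel)) (\<lambda>\<omega>. \<lambda>i\<in>I. Z i \<omega>)) (prod_emb I (\<lambda>_. borel) J (Pi\<^sub>E J A))
     = ennreal (\<integral>\<omega>. (\<Prod>i\<in>J. indicator (A i) (Z i \<omega>)) * cos (0 + (\<Sum>i\<in>J. 0 * Z i \<omega>)) \<partial>K)"
    if "prob_space K" and [measurable]: "\<And>i. i \<in> I \<Longrightarrow> Z i \<in> borel_measurable K"
      and J: "finite J" "J \<subseteq> I" and A: "\<And>i. i \<in> J \<Longrightarrow> A i \<in> sets borel"
    for K :: "'c measure" and Z J and A :: "'i \<Rightarrow> real set"
  proof -
    interpret K: prob_space K by fact
    have [measurable]: "A i \<in> sets borel" "Z i \<in> borel_measurable K" if "i \<in> J" for i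
      using that A J by auto
    have ind: "(\<Prod>i\<in>J. indicator (A i) (Z i \<omega>)) = (indicator {\<omega>\<in>space K. \<forall>i\<in>J. Z i \<omega> \<in> A i} \<omega> :: real)"
      if "\<omega> \<in> space K" for \<omega>
      using that J by (auto simp: indicator_def prod_zero_iff)
    have S: "{\<omega>\<in>space K. \<forall>i\<in>J. Z i \<omega> \<in> A i} \<in> sets K"
      using J(1) by measurable
    have "emeasure (distr K (Pi\<^sub>M I (\<lambda>_. borel)) (\<lambda>\<omega>. \<lambda>i\<in>I. Z i \<omega>)) (prod_emb I (\<lambda>_. borel) J (Pi\<^sub>E J A))
      = emeasure K {\<omega>\<in>space K. \<forall>i\<in>J. Z i \<omega> \<in> A i}"
    proof (subst emeasure_distr)
      show "prod_emb I (\<lambda>_. borel) J (Pi\<^sub>E J A) \<in> sets (Pi\<^sub>M I (\<lambda>_. borel))"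
        using J A by (intro sets_PiM_I) auto
      show "emeasure K ((\<lambda>\<omega>. \<lambda>i\<in>I. Z i \<omega>) -` prod_emb I (\<lambda>_. borel) J (Pi\<^sub>E J A) \<inter> space K) =
          emeasure K {\<omega>\<in>space K. \<forall>i\<in>J. Z i \<omega> \<in> A i}"
        using J(2) by (intro arg_cong[where f = "emeasure K"]) (auto simp: prod_emb_def PiE_iff subset_eq)
    qed simp
    also have "\<dots> = ennreal (\<integral>\<omega>. indicat_real {\<omega>\<in>space K. \<forall>i\<in>J. Z i \<omega> \<in> A i} \<omega> \<partial>K)"
      using S by (simp add: K.emeasure_eq_measure)
    also have "(\<integral>\<omega>. indicat_real {\<omega>\<in>space K. \<forall>i\<in>J. Z i \<omega> \<in> A i} \<omega> \<partial>K) = (\<integral>\<omega>. (\<Prod>i\<in>J. indicator (A i) (Z i \<omega>)) \<partial>K)"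
      by (intro Bochner_Integration.integral_cong refl) (simp add: ind)
    finally show ?thesis by (simp del: restrict_apply)
  qed
  show ?thesis
  proof (rule measure_eqI_PiM_infinite)
    fix J and A :: "'i \<Rightarrow> real set"
    assume J: "finite J" "J \<subseteq> I" and A: "\<And>i. i \<in> J \<Longrightarrow> A i \<in> sets borel"
    show "emeasure (distr M (Pi\<^sub>M I (\<lambda>_. borel)) (\<lambda>\<omega>. \<lambda>i\<in>I. X i \<omega>)) (prod_emb I (\<lambda>_. borel) J (Pi\<^sub>E J A))
      = emeasure (distr N (Pi\<^sub>M I (\<lambda>_. borel)) (\<lambda>\<omega>. \<lambda>i\<in>I. Y i \<omega>)) (prod_emb I (\<lambda>_. borel) J (Pi\<^sub>E J A))"
    proof (subst (1 2) cyl)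
      show "ennreal (\<integral>\<omega>. (\<Prod>i\<in>J. indicator (A i) (X i \<omega>)) * cos (0 + (\<Sum>i\<in>J. 0 * X i \<omega>)) \<partial>M) =
        ennreal (\<integral>\<omega>. (\<Prod>i\<in>J. indicator (A i) (Y i \<omega>)) * cos (0 + (\<Sum>i\<in>J. 0 * Y i \<omega>)) \<partial>N)"
        using J A eq by (intro arg_cong[where f = ennreal] cylinder_weighted_eqI assms) auto
    qed (use J A assms in auto)
  qed (use dM.finite_measure in \<open>auto intro: dM.finite_measure_axioms\<close>)
qed

section \<open>Centered Gaussian random variables\<close>

lemma centered_gaussian_rv_cases:
  assumes "centered_gaussian_rv M Y"
  obtains "AE \<omega> in M. Y \<omega> = 0"
  | \<sigma> where "\<sigma> > 0" "distributed M lborel Y (normal_density 0 \<sigma>)"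
  using assms unfolding centered_gaussian_rv_def by blast

lemma centered_gaussian_rv_measurable [measurable_dest]:
  "centered_gaussian_rv M Y \<Longrightarrow> Y \<in> borel_measurable M"
  by (simp add: centered_gaussian_rv_def)

text \<open>Completes the square. The shifted density has mass 1, so the prefactor is the moment
  generating function.\<close>

lemma normal_density_exp:
  assumes "\<sigma> > 0"
  shows "normal_density 0 \<sigma> x * exp (a * x) = exp (a\<^sup>2 * \<sigma>\<^sup>2 / 2) * normal_density (a * \<sigma>\<^sup>2) \<sigma> x"
proof -
  have "- x\<^sup>2 / (2 * \<sigma>\<^sup>2) + a * x = a\<^sup>2 * \<sigma>\<^sup>2 / 2 + - (x - a * \<sigma>\<^sup>2)\<^sup>2 / (2 * \<sigma>\<^sup>2)"
    using assms by (simp add: field_simps power2_eq_square)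
  then have "exp (- x\<^sup>2 / (2 * \<sigma>\<^sup>2)) * exp (a * x) = exp (a\<^sup>2 * \<sigma>\<^sup>2 / 2) * exp (- (x - a * \<sigma>\<^sup>2)\<^sup>2 / (2 * \<sigma>\<^sup>2))"
    by (simp only: exp_add[symmetric])
  then show ?thesis
    by (simp add: normal_density_def)
qed

text \<open>Real part of \<open>cis \<theta>\<close> times the characteristic function of the
  standard normal law; the substitution of \<open>\<sigma> * x\<close> for \<open>x\<close> brings
  in the variance.\<close>

lemma normal_density_integral_cos:
  assumes "\<sigma> > 0"
  shows "(\<integral>x. normal_density 0 \<sigma> x * cos (\<theta> + x) \<partial>lborel) = cos \<theta> * exp (- \<sigma>\<^sup>2 / 2)"
proof -
  interpret S: prob_space std_normal_distribution
    using real_dist_normal_dist by (rule real_distribution.axioms(1))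
  have iexp_int: "integrable std_normal_distribution (\<lambda>x. iexp (\<sigma> * x))"
    by (rule S.integrable_iexp) simp_all
  have "complex_of_real (exp (- \<sigma>\<^sup>2 / 2)) = (CLINT x|std_normal_distribution. iexp (\<sigma> * x))"
    using fun_cong[OF char_std_normal_distribution, of \<sigma>] by (simp add: char_def)
  then have "cis \<theta> * exp (- \<sigma>\<^sup>2 / 2) = (CLINT x|std_normal_distribution. cis \<theta> * iexp (\<sigma> * x))"
    using iexp_int by simp
  then have "Re (cis \<theta> * exp (- \<sigma>\<^sup>2 / 2)) = (\<integral>x. Re (cis \<theta> * iexp (\<sigma> * x)) \<partial>std_normal_distribution)"
    using iexp_int by (simp only:) (subst integral_Re[symmetric]; simp)
  also have "\<dots> = (\<integral>x. cos (\<theta> + \<sigma> * x) \<partial>std_normal_distribution)"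
  proof -
    have "cis \<theta> * iexp (\<sigma> * x) = cis (\<theta> + \<sigma> * x)" for x
      by (simp only: cis_conv_exp[symmetric] cis_mult)
    then show ?thesis by (simp only: cis.sel)
  qed
  also have "\<dots> = (\<integral>x. std_normal_density x * cos (\<theta> + \<sigma> * x) \<partial>lborel)"
    by (subst integral_real_density) auto
  also have "\<dots> = (\<integral>x. \<sigma> * (normal_density 0 \<sigma> (\<sigma> * x) * cos (\<theta> + \<sigma> * x)) \<partial>lborel)"
    using assms
    by (intro Bochner_Integration.integral_cong refl)
      (simp add: normal_density_def real_sqrt_mult field_simps power_mult_distrib)
  also have "\<dots> = \<bar>\<sigma>\<bar> *\<^sub>R (\<integral>x. normal_density 0 \<sigma> (0 + \<sigma> * x) * cos (\<theta> + (0 + \<sigma> * x)) \<partial>lborel)"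
    using assms by simp
  also have "\<dots> = (\<integral>x. normal_density 0 \<sigma> x * cos (\<theta> + x) \<partial>lborel)"
    using assms by (subst lborel_integral_real_affine[symmetric, where c = \<sigma> and t = 0]) auto
  finally show ?thesis by simp
qed

context
  fixes M :: "'a measure" and Y :: "'a \<Rightarrow> real"
  assumes M: "prob_space M" and Y: "centered_gaussian_rv M Y"
begin

interpretation prob_space M by (rule M)

lemma centered_gaussian_rv_square_integrable: "integrable M (\<lambda>\<omega>. (Y \<omega>)\<^sup>2)"
  using Y
proof (cases rule: centered_gaussian_rv_cases)
  case 1
  then have "AE \<omega> in M. (Y \<omega>)\<^sup>2 = 0" by auto
  then show ?thesis
    using Y by (subst integrable_cong_AE[where g = "\<lambda>_. 0"]) (auto dest: centered_gaussian_rv_measurable)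
next
  case (2 \<sigma>)
  have "integrable lborel (\<lambda>x. normal_density 0 \<sigma> x * (x - 0)\<^sup>2)"
    using 2 by (intro integrable_normal_moment)
  then show ?thesis
    using 2(1) by (subst distributed_integrable[OF 2(2), symmetric]) auto
qed

lemma distributed_normal_second_moment:
  assumes "\<sigma> > 0" "distributed M lborel Y (normal_density 0 \<sigma>)"
  shows "(\<integral>\<omega>. (Y \<omega>)\<^sup>2 \<partial>M) = \<sigma>\<^sup>2"
  using normal_distributed_variance[OF assms] normal_distributed_expectation[OF assms] by simp

lemma centered_gaussian_rv_mgf:
  "integrable M (\<lambda>\<omega>. exp (a * Y \<omega>))"
  "(\<integral>\<omega>. exp (a * Y \<omega>) \<partial>M) = exp (a\<^sup>2 * (\<integral>\<omega>. (Y \<omega>)\<^sup>2 \<partial>M) / 2)"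
proof -
  have "integrable M (\<lambda>\<omega>. exp (a * Y \<omega>)) \<and>
    (\<integral>\<omega>. exp (a * Y \<omega>) \<partial>M) = exp (a\<^sup>2 * (\<integral>\<omega>. (Y \<omega>)\<^sup>2 \<partial>M) / 2)"
    using Y
  proof (cases rule: centered_gaussian_rv_cases)
    case 1
    note [measurable] = centered_gaussian_rv_measurable[OF Y]
    have "AE \<omega> in M. exp (a * Y \<omega>) = 1" "AE \<omega> in M. (Y \<omega>)\<^sup>2 = 0" using 1 by auto
    then show ?thesis
      using integrable_cong_AE[of "\<lambda>\<omega>. exp (a * Y \<omega>)" M "\<lambda>_. 1"]
        integral_cong_AE[of "\<lambda>\<omega>. exp (a * Y \<omega>)" M "\<lambda>_. 1"]
        integral_cong_AE[of "\<lambda>\<omega>. (Y \<omega>)\<^sup>2" M "\<lambda>_. 0"]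
      by (simp add: prob_space)
  next
    case (2 \<sigma>)
    have "integrable lborel (\<lambda>x. normal_density 0 \<sigma> x * exp (a * x))"
      using 2 by (simp add: normal_density_exp)
    moreover have "(\<integral>x. normal_density 0 \<sigma> x * exp (a * x) \<partial>lborel) = exp (a\<^sup>2 * \<sigma>\<^sup>2 / 2)"
      using 2 by (simp add: normal_density_exp)
    ultimately show ?thesis
      using distributed_integrable[OF 2(2), of "\<lambda>x. exp (a * x)"] distributed_integral[OF 2(2), of "\<lambda>x. exp (a * x)"]
        distributed_normal_second_moment[OF 2] 2(1) by simp
  qed
  then show "integrable M (\<lambda>\<omega>. exp (a * Y \<omega>))"
    "(\<integral>\<omega>. exp (a * Y \<omega>) \<partial>M) = exp (a\<^sup>2 * (\<integral>\<omega>. (Y \<omega>)\<^sup>2 \<partial>M) / 2)" by auto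
qed

text \<open>In the degenerate and in the normal case alike the value depends on the second moment
  only. Equality of Gaussian laws thereby reduces to comparing second moments of
  combinations.\<close>

lemma centered_gaussian_rv_integral_cos:
  "(\<integral>\<omega>. cos (\<theta> + Y \<omega>) \<partial>M) = cos \<theta> * exp (- (\<integral>\<omega>. (Y \<omega>)\<^sup>2 \<partial>M) / 2)"
  using Y
proof (cases rule: centered_gaussian_rv_cases)
  case 1
  note [measurable] = centered_gaussian_rv_measurable[OF Y]
  have "AE \<omega> in M. cos (\<theta> + Y \<omega>) = cos \<theta>" "AE \<omega> in M. (Y \<omega>)\<^sup>2 = 0" using 1 by auto
  then show ?thesis
    using integral_cong_AE[of "\<lambda>\<omega>. cos (\<theta> + Y \<omega>)" M "\<lambda>_. cos \<theta>"]
      integral_cong_AE[of "\<lambda>\<omega>. (Y \<omega>)\<^sup>2" M "\<lambda>_. 0"]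
    by (simp add: prob_space)
next
  case (2 \<sigma>)
  then show ?thesis
    using distributed_integral[OF 2(2), of "\<lambda>x. cos (\<theta> + x)"] normal_density_integral_cos[OF 2(1), of \<theta>]
      distributed_normal_second_moment[OF 2] by simp
qed

text \<open>Chernoff's bound with the optimal parameter \<open>a / v\<close>. Only an upper bound
  \<open>v > 0\<close> of the variance enters, so that variance 0 is included.\<close>

lemma centered_gaussian_rv_tail:
  assumes v: "(\<integral>\<omega>. (Y \<omega>)\<^sup>2 \<partial>M) \<le> v" "v > 0" and a: "a > 0"
  shows "prob {\<omega>\<in>space M. Y \<omega> > a} \<le> exp (- a\<^sup>2 / (2 * v))"
proof -
  note [measurable] = centered_gaussian_rv_measurable[OF Y]
  have "prob {\<omega>\<in>space M. Y \<omega> > a} \<le> prob {\<omega>\<in>space M. exp ((a/v) * Y \<omega>) \<ge> exp (a\<^sup>2 / v)}"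
    using assms by (intro finite_measure_mono) (auto simp: power2_eq_square field_simps)
  also have "\<dots> \<le> (\<integral>\<omega>. exp ((a/v) * Y \<omega>) \<partial>M) / exp (a\<^sup>2 / v)"
    by (intro integral_Markov_inequality_measure[where A = "{}"] centered_gaussian_rv_mgf) auto
  also have "\<dots> = exp ((a/v)\<^sup>2 * (\<integral>\<omega>. (Y \<omega>)\<^sup>2 \<partial>M) / 2 - a\<^sup>2 / v)"
    unfolding centered_gaussian_rv_mgf(2) exp_diff ..
  also have "\<dots> \<le> exp ((a/v)\<^sup>2 * v / 2 - a\<^sup>2 / v)"
    using v by (intro iffD2[OF exp_le_cancel_iff] diff_right_mono divide_right_mono mult_left_mono) auto
  also have "(a/v)\<^sup>2 * v / 2 - a\<^sup>2 / v = - a\<^sup>2 / (2 * v)"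
    using v by (simp add: field_simps power2_eq_square)
  finally show ?thesis .
qed

end

section \<open>Gaussian families and Fernique's tail bound\<close>

text \<open>The condition of \<open>centered_gaussian_process\<close> over an arbitrary index set:
  \<open>X\<close> lives on \<open>{0..}\<close>, its time change on the whole line, and increments
  on a countable set.\<close>

definition gaussian_family :: "'a measure \<Rightarrow> 'i set \<Rightarrow> ('i \<Rightarrow> 'a \<Rightarrow> real) \<Rightarrow> bool" where
  "gaussian_family M I Z \<longleftrightarrow>
     (\<forall>J c. finite J \<longrightarrow> J \<subseteq> I \<longrightarrow> centered_gaussian_rv M (\<lambda>\<omega>. \<Sum>t\<in>J. c t * Z t \<omega>))"

text \<open>The map \<open>f\<close> may identify indices: coefficients are added up over each
  fibre. Increments need this, because they use the same base time repeatedly.\<close>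

lemma gaussian_family_reindex:
  assumes "gaussian_family M I Z" "finite J" "f ` J \<subseteq> I"
  shows "centered_gaussian_rv M (\<lambda>\<omega>. \<Sum>j\<in>J. c j * Z (f j) \<omega>)"
proof -
  have "(\<Sum>j\<in>J. c j * Z (f j) \<omega>) = (\<Sum>t\<in>f ` J. (\<Sum>j\<in>{j\<in>J. f j = t}. c j) * Z t \<omega>)" for \<omega>
    using assms(2) by (subst sum.image_gen[where g = f]) (auto intro!: sum.cong simp: sum_distrib_right)
  then show ?thesis
    using assms unfolding gaussian_family_def by simp
qed

lemma gaussian_family_component:
  assumes "gaussian_family M I Z" "t \<in> I"
  shows "centered_gaussian_rv M (Z t)"
  using gaussian_family_reindex[OF assms(1), of "{()}" "\<lambda>_. t" "\<lambda>_. 1"] assms(2) by simp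

lemma gaussian_family_two:
  assumes "gaussian_family M I Z" "s \<in> I" "t \<in> I"
  shows "centered_gaussian_rv M (\<lambda>\<omega>. a * Z s \<omega> + b * Z t \<omega>)"
  using gaussian_family_reindex[OF assms(1), of UNIV "\<lambda>x. if x then s else t" "\<lambda>x. if x then a else b"] assms(2-)
  by (simp add: UNIV_bool add.commute)

lemma gaussian_family_distr_eqI:
  fixes Z :: "'i \<Rightarrow> 'a \<Rightarrow> real" and W :: "'i \<Rightarrow> 'b \<Rightarrow> real"
  assumes "prob_space M" "prob_space N" "gaussian_family M I Z" "gaussian_family N I W"
    and "\<And>J c. finite J \<Longrightarrow> J \<subseteq> I \<Longrightarrow>
      (\<integral>\<omega>. (\<Sum>t\<in>J. c t * Z t \<omega>)\<^sup>2 \<partial>M) = (\<integral>\<omega>. (\<Sum>t\<in>J. c t * W t \<omega>)\<^sup>2 \<partial>N)"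
  shows "distr M (Pi\<^sub>M I (\<lambda>_. borel)) (\<lambda>\<omega>. \<lambda>t\<in>I. Z t \<omega>) = distr N (Pi\<^sub>M I (\<lambda>_. borel)) (\<lambda>\<omega>. \<lambda>t\<in>I. W t \<omega>)"
proof (rule distr_PiM_eqI_cos)
  fix J \<theta> and c :: "'i \<Rightarrow> real" assume J: "finite J" "J \<subseteq> I"
  then have "centered_gaussian_rv M (\<lambda>\<omega>. \<Sum>t\<in>J. c t * Z t \<omega>)" "centered_gaussian_rv N (\<lambda>\<omega>. \<Sum>t\<in>J. c t * W t \<omega>)"
    using assms(3,4) unfolding gaussian_family_def by auto
  then show "(\<integral>\<omega>. cos (\<theta> + (\<Sum>i\<in>J. c i * Z i \<omega>)) \<partial>M) = (\<integral>\<omega>. cos (\<theta> + (\<Sum>i\<in>J. c i * W i \<omega>)) \<partial>N)"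
    using assms(5)[OF J, of c]
      centered_gaussian_rv_integral_cos[OF assms(1), of "\<lambda>\<omega>. \<Sum>t\<in>J. c t * Z t \<omega>"]
      centered_gaussian_rv_integral_cos[OF assms(2), of "\<lambda>\<omega>. \<Sum>t\<in>J. c t * W t \<omega>"] by simp
qed (use assms in \<open>auto intro: centered_gaussian_rv_measurable gaussian_family_component\<close>)

text \<open>By Fubini, \<open>\<theta> + A x\<close> is a mere phase for the inner integral. The
  result depends on \<open>A\<close> and \<open>B\<close> only through the sum of their second
  moments, which a rotation preserves.\<close>

lemma integral_cos_independent_sum:
  assumes M: "prob_space M" and A: "centered_gaussian_rv M A" and B: "centered_gaussian_rv M B"
  shows "(\<integral>p. cos (\<theta> + (A (fst p) + B (snd p))) \<partial>(M \<Otimes>\<^sub>M M)) =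
     cos \<theta> * exp (- (\<integral>\<omega>. (A \<omega>)\<^sup>2 + (B \<omega>)\<^sup>2 \<partial>M) / 2)"
proof -
  interpret M: prob_space M by (rule M)
  interpret P: pair_prob_space M M ..
  note [measurable] = A[THEN centered_gaussian_rv_measurable] B[THEN centered_gaussian_rv_measurable]
  have "integrable (M \<Otimes>\<^sub>M M) (\<lambda>p. cos (\<theta> + (A (fst p) + B (snd p))))"
    by (rule P.integrable_const_bound[of _ 1]) auto
  then have "(\<integral>p. cos (\<theta> + (A (fst p) + B (snd p))) \<partial>(M \<Otimes>\<^sub>M M)) = (\<integral>x. (\<integral>y. cos ((\<theta> + A x) + B y) \<partial>M) \<partial>M)"
    by (subst P.integral_fst'[symmetric]) (simp_all add: add.assoc)
  also have "\<dots> = (\<integral>x. cos (\<theta> + A x) \<partial>M) * exp (- (\<integral>\<omega>. (B \<omega>)\<^sup>2 \<partial>M) / 2)"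
    using M B by (simp add: centered_gaussian_rv_integral_cos)
  also have "\<dots> = cos \<theta> * exp (- (\<integral>\<omega>. (A \<omega>)\<^sup>2 + (B \<omega>)\<^sup>2 \<partial>M) / 2)"
    using M A B
    by (simp add: centered_gaussian_rv_integral_cos centered_gaussian_rv_square_integrable
        mult.assoc exp_add[symmetric] add_divide_distrib diff_divide_distrib)
  finally show ?thesis .
qed

text \<open>Two independent copies are invariant under rotation by 45 degrees. If a combination of
  \<open>U\<close> has the parts \<open>p\<close> and \<open>q\<close> in the two copies, the same
  combination of \<open>W\<close> has the parts \<open>(p + q) / sqrt 2\<close> and
  \<open>(q - p) / sqrt 2\<close>, with the same sum of squares.\<close>

lemma gaussian_pair_rotation:
  fixes Z :: "'i \<Rightarrow> 'a \<Rightarrow> real"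
  assumes M: "prob_space M" and Z: "gaussian_family M I Z"
  defines "U \<equiv> \<lambda>(t, b) p. if b then Z t (fst p) else Z t (snd p)"
    and "W \<equiv> \<lambda>(t, b) p. if b then (Z t (fst p) - Z t (snd p)) / sqrt 2 else (Z t (fst p) + Z t (snd p)) / sqrt 2"
  shows "distr (M \<Otimes>\<^sub>M M) (Pi\<^sub>M (I \<times> UNIV) (\<lambda>_. borel)) (\<lambda>p. \<lambda>i\<in>I \<times> UNIV. U i p) =
         distr (M \<Otimes>\<^sub>M M) (Pi\<^sub>M (I \<times> UNIV) (\<lambda>_. borel)) (\<lambda>p. \<lambda>i\<in>I \<times> UNIV. W i p)"
proof -
  interpret M: prob_space M by (rule M)
  interpret P: pair_prob_space M M ..
  have [measurable]: "Z t \<in> borel_measurable M" if "t \<in> I" for t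
    using Z that by (auto intro: centered_gaussian_rv_measurable gaussian_family_component)
  have combo: "(\<integral>p. cos (\<theta> + (\<Sum>j\<in>J. c j * (a (snd j) * Z (fst j) (fst p) + b (snd j) * Z (fst j) (snd p)))) \<partial>(M \<Otimes>\<^sub>M M))
     = cos \<theta> * exp (- (\<integral>\<omega>. (\<Sum>j\<in>J. (c j * a (snd j)) * Z (fst j) \<omega>)\<^sup>2 + (\<Sum>j\<in>J. (c j * b (snd j)) * Z (fst j) \<omega>)\<^sup>2 \<partial>M) / 2)"
    if J: "finite J" "J \<subseteq> I \<times> UNIV" for J \<theta> and c :: "'i \<times> bool \<Rightarrow> real" and a b :: "bool \<Rightarrow> real"
  proof -
    have "fst ` J \<subseteq> I" using J by auto
    then show ?thesis
      using integral_cos_independent_sum[OF M gaussian_family_reindex[OF Z J(1)] gaussian_family_reindex[OF Z J(1)],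
        of fst fst \<theta> "\<lambda>j. c j * a (snd j)" "\<lambda>j. c j * b (snd j)"]
      by (simp add: distrib_left sum.distrib mult.assoc)
  qed
  have U_eq: "U j p = of_bool (snd j) * Z (fst j) (fst p) + of_bool (\<not> snd j) * Z (fst j) (snd p)" for j p
    by (simp add: U_def split: prod.splits)
  have W_eq: "W j p = (1 / sqrt 2) * Z (fst j) (fst p) + (if snd j then - 1 / sqrt 2 else 1 / sqrt 2) * Z (fst j) (snd p)" for j p
    by (simp add: W_def add_divide_distrib diff_divide_distrib split: prod.splits)
  show ?thesis
  proof (rule distr_PiM_eqI_cos)
    fix J :: "('i \<times> bool) set" and \<theta> and c :: "'i \<times> bool \<Rightarrow> real" assume J: "finite J" "J \<subseteq> I \<times> UNIV"
    \<comment> \<open>Both parts may be evaluated at the same \<open>\<omega>\<close>, since after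
      \<open>combo\<close> only expectations over one copy are left.\<close>
    have "(\<Sum>j\<in>J. (c j * of_bool (snd j)) * Z (fst j) \<omega>)\<^sup>2 + (\<Sum>j\<in>J. (c j * of_bool (\<not> snd j)) * Z (fst j) \<omega>)\<^sup>2
       = (\<Sum>j\<in>J. (c j * (1 / sqrt 2)) * Z (fst j) \<omega>)\<^sup>2 + (\<Sum>j\<in>J. (c j * (if snd j then - 1 / sqrt 2 else 1 / sqrt 2)) * Z (fst j) \<omega>)\<^sup>2" for \<omega>
    proof -
      define p q where "p = (\<Sum>j\<in>J. (c j * of_bool (snd j)) * Z (fst j) \<omega>)"
        and "q = (\<Sum>j\<in>J. (c j * of_bool (\<not> snd j)) * Z (fst j) \<omega>)"
      have "(\<Sum>j\<in>J. (c j * (1 / sqrt 2)) * Z (fst j) \<omega>) = (p + q) / sqrt 2"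
        unfolding p_def q_def sum.distrib[symmetric] sum_divide_distrib by (rule sum.cong) auto
      moreover have "(\<Sum>j\<in>J. (c j * (if snd j then - 1 / sqrt 2 else 1 / sqrt 2)) * Z (fst j) \<omega>) = (q - p) / sqrt 2"
        unfolding p_def q_def sum_subtractf[symmetric] sum_divide_distrib by (rule sum.cong) auto
      moreover have "p\<^sup>2 + q\<^sup>2 = ((p + q) / sqrt 2)\<^sup>2 + ((q - p) / sqrt 2)\<^sup>2"
        by (simp add: power_divide power2_sum power2_diff add_divide_distrib diff_divide_distrib)
      ultimately show ?thesis
        by (simp only: p_def[symmetric] q_def[symmetric])
    qed
    then show "(\<integral>p. cos (\<theta> + (\<Sum>i\<in>J. c i * U i p)) \<partial>(M \<Otimes>\<^sub>M M)) = (\<integral>p. cos (\<theta> + (\<Sum>i\<in>J. c i * W i p)) \<partial>(M \<Otimes>\<^sub>M M))"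
      unfolding U_eq W_eq
      using combo[OF J, of \<theta> c "\<lambda>x. of_bool x" "\<lambda>x. of_bool (\<not> x)"]
        combo[OF J, of \<theta> c "\<lambda>x. 1 / sqrt 2" "\<lambda>x. if x then - 1 / sqrt 2 else 1 / sqrt 2"] by simp
  next
    fix i assume "i \<in> I \<times> (UNIV :: bool set)"
    then have [measurable]: "Z (fst i) \<in> borel_measurable M" by auto
    show "U i \<in> borel_measurable (M \<Otimes>\<^sub>M M)" "W i \<in> borel_measurable (M \<Otimes>\<^sub>M M)"
      unfolding U_eq[abs_def] W_eq[abs_def] by measurable
  qed (rule P.prob_space_axioms)+
qed

text \<open>If \<open>\<bar>x - y\<bar> / sqrt 2 \<le> s\<close> and \<open>\<bar>x + y\<bar> / sqrt 2 > u\<close>, then both \<open>\<bar>x\<bar>\<close> and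
  \<open>\<bar>y\<bar>\<close> exceed \<open>(u - s) / sqrt 2\<close>.\<close>

lemma fernique_inequality:
  fixes Z :: "'i \<Rightarrow> 'a \<Rightarrow> real"
  assumes M: "prob_space M" and Z: "gaussian_family M I Z" and I: "countable I"
  defines "F \<equiv> \<lambda>a. measure M {\<omega>\<in>space M. \<exists>t\<in>I. \<bar>Z t \<omega>\<bar> > a}"
  shows "(1 - F s) * F u \<le> (F ((u - s) / sqrt 2))\<^sup>2"
proof -
  interpret M: prob_space M by (rule M)
  interpret P: pair_prob_space M M ..
  have Zm [measurable]: "Z t \<in> borel_measurable M" if "t \<in> I" for t
    using Z that by (auto intro: centered_gaussian_rv_measurable gaussian_family_component)
  define V where "V a = {\<omega>\<in>space M. \<exists>t\<in>I. \<bar>Z t \<omega>\<bar> > a}" for a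
  have V [measurable]: "V a \<in> sets M" for a
    unfolding V_def using I by measurable
  define E where "E = {f\<in>space (Pi\<^sub>M (I \<times> UNIV) (\<lambda>_. borel)). (\<forall>t\<in>I. \<bar>f (t, True)\<bar> \<le> s) \<and> (\<exists>t\<in>I. \<bar>f (t, False)\<bar> > (u::real))}"
  have E: "E \<in> sets (Pi\<^sub>M (I \<times> UNIV) (\<lambda>_. borel))"
  proof -
    have [measurable]: "(\<lambda>f. f (t, b)) \<in> borel_measurable (Pi\<^sub>M (I \<times> UNIV) (\<lambda>_. borel :: real measure))"
      if "t \<in> I" for t b
      using that by (intro measurable_component_singleton) auto
    show ?thesis unfolding E_def using I by measurable
  qed
  let ?U = "\<lambda>(t, b) p. if b then Z t (fst p) else Z t (snd p)"
  let ?W = "\<lambda>(t, b) p. if b then (Z t (fst p) - Z t (snd p)) / sqrt 2 else (Z t (fst p) + Z t (snd p)) / sqrt 2"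
  have Um: "(\<lambda>p. \<lambda>i\<in>I \<times> UNIV. ?U i p) \<in> M \<Otimes>\<^sub>M M \<rightarrow>\<^sub>M Pi\<^sub>M (I \<times> UNIV) (\<lambda>_. borel)"
    by (rule measurable_restrict) auto
  have Wm: "(\<lambda>p. \<lambda>i\<in>I \<times> UNIV. ?W i p) \<in> M \<Otimes>\<^sub>M M \<rightarrow>\<^sub>M Pi\<^sub>M (I \<times> UNIV) (\<lambda>_. borel)"
    by (rule measurable_restrict) auto
  have times: "measure (M \<Otimes>\<^sub>M M) (A \<times> B) = measure M A * measure M B" if "A \<in> sets M" "B \<in> sets M" for A B
    using that by (simp add: measure_def M.emeasure_pair_measure_Times enn2real_mult)
  have "(1 - F s) * F u = measure M (space M - V s) * measure M (V u)"
    by (simp add: F_def V_def[symmetric] M.prob_compl)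
  also have "\<dots> = measure (M \<Otimes>\<^sub>M M) ((space M - V s) \<times> V u)"
    by (intro times[symmetric]) auto
  \<comment> \<open>For \<open>U\<close> the event \<open>E\<close> says that the first copy stays
    below \<open>s\<close> and the second exceeds \<open>u\<close> somewhere. The rotation replaces
    this by the same statement about differences and sums.\<close>
  also have "(space M - V s) \<times> V u = (\<lambda>p. \<lambda>i\<in>I \<times> UNIV. ?U i p) -` E \<inter> space (M \<Otimes>\<^sub>M M)"
    by (auto simp: V_def E_def space_PiM space_pair_measure not_less)
  also have "measure (M \<Otimes>\<^sub>M M) \<dots> = measure (M \<Otimes>\<^sub>M M) ((\<lambda>p. \<lambda>i\<in>I \<times> UNIV. ?W i p) -` E \<inter> space (M \<Otimes>\<^sub>M M))"
    using arg_cong[OF gaussian_pair_rotation[OF M Z], of "\<lambda>K. measure K E"]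
    by (simp only: measure_distr[OF Um E] measure_distr[OF Wm E])
  also have "\<dots> \<le> measure (M \<Otimes>\<^sub>M M) (V ((u - s) / sqrt 2) \<times> V ((u - s) / sqrt 2))"
  proof (intro P.finite_measure_mono subsetI)
    fix p assume "p \<in> (\<lambda>p. \<lambda>i\<in>I \<times> UNIV. ?W i p) -` E \<inter> space (M \<Otimes>\<^sub>M M)"
    then obtain t where p: "fst p \<in> space M" "snd p \<in> space M" and t: "t \<in> I"
      and 1: "\<bar>(Z t (fst p) - Z t (snd p)) / sqrt 2\<bar> \<le> s" and 2: "\<bar>(Z t (fst p) + Z t (snd p)) / sqrt 2\<bar> > u"
      by (auto simp: E_def space_PiM space_pair_measure)
    define a b where "a = Z t (fst p) / sqrt 2" and "b = Z t (snd p) / sqrt 2"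
    have "\<bar>a - b\<bar> \<le> s" "\<bar>a + b\<bar> > u"
      using 1 2 by (simp_all add: a_def b_def diff_divide_distrib add_divide_distrib)
    then have "2 * \<bar>a\<bar> > u - s" "2 * \<bar>b\<bar> > u - s" by linarith+
    moreover have "2 * \<bar>a\<bar> = sqrt 2 * \<bar>Z t (fst p)\<bar>" "2 * \<bar>b\<bar> = sqrt 2 * \<bar>Z t (snd p)\<bar>"
      by (simp_all add: a_def b_def field_simps)
    ultimately have "\<bar>Z t (fst p)\<bar> > (u - s) / sqrt 2" "\<bar>Z t (snd p)\<bar> > (u - s) / sqrt 2"
      by (simp_all add: field_simps)
    then show "p \<in> V ((u - s) / sqrt 2) \<times> V ((u - s) / sqrt 2)"
      using p t by (auto simp: V_def mem_Times_iff)
  qed auto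
  also have "\<dots> = (F ((u - s) / sqrt 2))\<^sup>2"
    by (subst times) (auto simp: F_def V_def[symmetric] power2_eq_square)
  finally show ?thesis .
qed

text \<open>With \<open>1 - F s \<ge> 3/4\<close>, Fernique's inequality says that
  \<open>F / (3/4)\<close> is at least squared when the level grows by about a factor
  \<open>sqrt 2\<close>. Starting from at most 1/3, the logarithm of the tail doubles together with
  the square of the level, which is Gaussian decay.\<close>

lemma fernique_tail:
  fixes Z :: "'i \<Rightarrow> 'a \<Rightarrow> real"
  assumes M: "prob_space M" and Z: "gaussian_family M I Z" and I: "countable I"
  assumes s: "s > 0" "measure M {\<omega>\<in>space M. \<exists>t\<in>I. \<bar>Z t \<omega>\<bar> > s} \<le> 1/4" and a: "a \<ge> 4 * s"
  shows "measure M {\<omega>\<in>space M. \<exists>t\<in>I. \<bar>Z t \<omega>\<bar> > a} \<le> exp (- a\<^sup>2 / (32 * s\<^sup>2))"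
proof -
  interpret M: prob_space M by (rule M)
  define F where "F a = measure M {\<omega>\<in>space M. \<exists>t\<in>I. \<bar>Z t \<omega>\<bar> > a}" for a
  have [measurable]: "Z t \<in> borel_measurable M" if "t \<in> I" for t
    using Z that by (auto intro: centered_gaussian_rv_measurable gaussian_family_component)
  have F0: "F x \<ge> 0" for x by (simp add: F_def)
  have anti: "F y \<le> F x" if "x \<le> y" for x y
    unfolding F_def using I that by (intro M.finite_measure_mono) force+
  have step: "F (s + sqrt 2 * x) * (3/4) \<le> (F x)\<^sup>2" for x
  proof -
    have "(1 - F s) * F (s + sqrt 2 * x) \<le> (F x)\<^sup>2"
      using fernique_inequality[OF M Z I, of s "s + sqrt 2 * x"] by (simp add: F_def)
    moreover have "3/4 * F (s + sqrt 2 * x) \<le> (1 - F s) * F (s + sqrt 2 * x)"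
      using s F0 by (intro mult_right_mono) (auto simp: F_def)
    ultimately show ?thesis by simp
  qed
  \<comment> \<open>the levels dominate the recursion \<open>t (Suc n) = s + sqrt 2 * t n\<close>, \<open>t 0 = s\<close>\<close>
  have tower: "F (s * (4 * sqrt 2 ^ n - 3)) \<le> 3/4 * (1/3) ^ (2 ^ n)" for n
  proof (induction n)
    case 0
    then show ?case using s by (simp add: F_def)
  next
    case (Suc n)
    define x where "x = s * (4 * sqrt 2 ^ n - 3)"
    \<comment> \<open>The induction step comes down to
      \<open>1 - 3 * sqrt 2 \<le> - 3\<close>.\<close>
    have "4 / 3 \<le> sqrt 2"
      by (rule real_le_rsqrt) (simp add: power2_eq_square)
    then have "1 + sqrt 2 * (4 * sqrt 2 ^ n - 3) \<le> 4 * sqrt 2 ^ Suc n - 3"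
      by (simp add: algebra_simps)
    then have "s + sqrt 2 * x \<le> s * (4 * sqrt 2 ^ Suc n - 3)"
      using s mult_left_mono[of _ _ s] unfolding x_def by (fastforce simp: algebra_simps)
    then have "F (s * (4 * sqrt 2 ^ Suc n - 3)) * (3/4) \<le> (F x)\<^sup>2"
      using anti step[of x] by fastforce
    also have "\<dots> \<le> (3/4 * (1/3) ^ (2 ^ n))\<^sup>2"
      using Suc F0 unfolding x_def by (intro power_mono) auto
    also have "\<dots> = (3/4)\<^sup>2 * (1/3) ^ (2 ^ Suc n)"
      unfolding power_mult_distrib power_mult[symmetric] by (simp add: mult.commute)
    finally show ?case by (simp add: power2_eq_square)
  qed
  \<comment> \<open>\<open>2 ^ n \<le> x\<close> means \<open>4 * s * sqrt 2 ^ n \<le> a\<close>.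
    The hypothesis on \<open>a\<close> makes \<open>n = 0\<close> admissible, and the largest such
    \<open>n\<close> has \<open>2 ^ n > x / 2\<close>, whence the 32 in the exponent.\<close>
  define x where "x = a\<^sup>2 / (16 * s\<^sup>2)"
  have x1: "x \<ge> 1"
    using power_mono[OF a, of 2] s by (simp add: x_def power_mult_distrib)
  obtain n where n: "2 ^ n \<le> x" "x < 2 ^ Suc n"
  proof -
    define m where "m = (LEAST m. x < 2 ^ m)"
    have m: "x < 2 ^ m"
      unfolding m_def using real_arch_pow[of 2 x] by (auto intro: LeastI)
    then obtain k where k: "m = Suc k"
      using x1 by (cases m) auto
    then have "\<not> x < 2 ^ k"
      using not_less_Least[of k "\<lambda>m. x < 2 ^ m"] unfolding m_def by simp
    then show ?thesis using m k by (intro that[of k]) auto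
  qed
  have "(4 * s * sqrt 2 ^ n)\<^sup>2 \<le> a\<^sup>2"
  proof -
    have "(4 * s * sqrt 2 ^ n)\<^sup>2 = 16 * s\<^sup>2 * 2 ^ n"
    proof -
      have "(sqrt 2 ^ n)\<^sup>2 = 2 ^ n"
        by (subst power_mult[symmetric], subst mult.commute, subst power_mult) simp
      then show ?thesis by (simp add: power_mult_distrib)
    qed
    also have "\<dots> \<le> 16 * s\<^sup>2 * x" using n by (intro mult_left_mono) auto
    also have "\<dots> = a\<^sup>2" using s by (simp add: x_def)
    finally show ?thesis .
  qed
  then have "4 * s * sqrt 2 ^ n \<le> a"
  proof (rule power2_le_imp_le)
    show "0 \<le> a" using a s by linarith
  qed
  then have "s * (4 * sqrt 2 ^ n - 3) \<le> a"
    using s by (simp add: algebra_simps)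
  then have "F a \<le> 3/4 * (1/3) ^ (2 ^ n)"
    by (rule order_trans[OF anti tower])
  also have "\<dots> \<le> 1 * exp (-1) ^ (2 ^ n)"
  proof (intro mult_mono power_mono)
    show "1 / 3 \<le> exp (- 1 :: real)" using exp_le by (simp add: exp_minus field_simps)
  qed auto
  also have "\<dots> = exp (- (2 ^ n))"
    by (simp flip: exp_of_nat_mult)
  also have "\<dots> \<le> exp (- x / 2)"
    using n by simp
  also have "- x / 2 = - a\<^sup>2 / (32 * s\<^sup>2)" by (simp add: x_def)
  finally show ?thesis by (simp add: F_def)
qed

section \<open>Stationary Gaussian processes: upper bound\<close>

text \<open>A violation at \<open>t\<close> persists on a neighbourhood, which meets the interval in
  a nonempty open set and so contains a rational point. Oscillation events can thus be formed over a
  countable, hence measurable, set of times.\<close>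

lemma le_on_rationals_imp_le:
  fixes g :: "real \<Rightarrow> real"
  assumes cont: "continuous_on UNIV g" and "\<delta> > 0" and le: "\<And>x. x \<in> \<rat> \<inter> {0..\<delta>} \<Longrightarrow> g x \<le> c"
    and t: "t \<in> {0..\<delta>}"
  shows "g t \<le> c"
proof (rule ccontr)
  assume "\<not> g t \<le> c"
  then have "isCont g t" "g t > c"
    using cont by (auto simp: continuous_on_eq_continuous_at)
  then have "eventually (\<lambda>x. g x > c) (nhds t)"
    by (auto simp: isCont_def tendsto_at_iff_tendsto_nhds intro: order_tendstoD)
  then obtain d where d: "d > 0" "\<And>x. \<bar>x - t\<bar> < d \<Longrightarrow> g x > c"
    by (auto simp: eventually_nhds_metric dist_real_def)
  have "max 0 (t - d) < min \<delta> (t + d)"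
    using d t \<open>\<delta> > 0\<close> by auto
  then obtain x where "x \<in> \<rat>" "max 0 (t - d) < x" "x < min \<delta> (t + d)"
    using Rats_dense_in_real by blast
  then show False
    using d(2)[of x] le[of x] by (auto simp: abs_less_iff)
qed

text \<open>Only the covariance is required to be stationary; shift invariance of the whole law is
  derived from Gaussianity. The degenerate case \<open>r 0 = 0\<close> is allowed.\<close>

locale stationary_gaussian = prob_space M for M :: "'a measure" +
  fixes Y :: "real \<Rightarrow> 'a \<Rightarrow> real" and r :: "real \<Rightarrow> real"
  assumes gaussian: "gaussian_family M UNIV Y"
    and paths: "\<And>\<omega>. \<omega> \<in> space M \<Longrightarrow> continuous_on UNIV (\<lambda>u. Y u \<omega>)"
    and covariance: "\<And>u v. expectation (\<lambda>\<omega>. Y u \<omega> * Y v \<omega>) = r \<bar>u - v\<bar>"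
begin

lemma gaussian_rv: "centered_gaussian_rv M (Y u)"
  using gaussian_family_component[OF gaussian] by simp

lemma measurable_Y [measurable]: "Y u \<in> borel_measurable M"
  using gaussian_rv by (rule centered_gaussian_rv_measurable)

lemma integrable_Y_mult: "integrable M (\<lambda>\<omega>. Y u \<omega> * Y v \<omega>)"
proof (rule Bochner_Integration.integrable_bound)
  show "integrable M (\<lambda>\<omega>. (Y u \<omega>)\<^sup>2 + (Y v \<omega>)\<^sup>2)"
    by (intro Bochner_Integration.integrable_add centered_gaussian_rv_square_integrable[OF prob_space_axioms gaussian_rv])
  have "\<bar>x * y\<bar> \<le> x\<^sup>2 + y\<^sup>2" for x y :: real
    using sum_squares_bound[of "\<bar>x\<bar>" "\<bar>y\<bar>"] mult_nonneg_nonneg[of "\<bar>x\<bar>" "\<bar>y\<bar>"]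
    unfolding abs_mult power2_abs by linarith
  then show "AE \<omega> in M. norm (Y u \<omega> * Y v \<omega>) \<le> norm ((Y u \<omega>)\<^sup>2 + (Y v \<omega>)\<^sup>2)"
    by (auto intro!: AE_I2 intro: order_trans)
qed simp

lemma second_moment: "expectation (\<lambda>\<omega>. (Y u \<omega>)\<^sup>2) = r 0"
  using covariance[of u u] by (simp add: power2_eq_square)

lemma r0_nonneg: "r 0 \<ge> 0"
  unfolding second_moment[of 0, symmetric] by (rule Bochner_Integration.integral_nonneg) simp

lemma second_moment_sum:
  assumes "finite J"
  shows "expectation (\<lambda>\<omega>. (\<Sum>t\<in>J. c t * Y (f t) \<omega>)\<^sup>2) = (\<Sum>s\<in>J. \<Sum>t\<in>J. c s * c t * r \<bar>f s - f t\<bar>)"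
proof -
  have "(\<Sum>t\<in>J. c t * Y (f t) \<omega>)\<^sup>2 = (\<Sum>s\<in>J. \<Sum>t\<in>J. (c s * c t) * (Y (f s) \<omega> * Y (f t) \<omega>))" for \<omega>
    by (simp add: power2_eq_square sum_product mult_ac)
  then show ?thesis
    using integrable_Y_mult by (simp add: covariance)
qed

section \<open>Shift invariance and oscillation over short intervals\<close>

lemma shift_invariant_law:
  "distr M (Pi\<^sub>M UNIV (\<lambda>_. borel)) (\<lambda>\<omega>. \<lambda>t\<in>UNIV. Y (a + t) \<omega>) = distr M (Pi\<^sub>M UNIV (\<lambda>_. borel)) (\<lambda>\<omega>. \<lambda>t\<in>UNIV. Y t \<omega>)"
proof (rule gaussian_family_distr_eqI[OF prob_space_axioms prob_space_axioms _ gaussian])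
  show "gaussian_family M UNIV (\<lambda>t. Y (a + t))"
    unfolding gaussian_family_def
    by (intro allI impI gaussian_family_reindex[OF gaussian, where f = "\<lambda>t. a + t"]) auto
  fix J c assume "finite (J :: real set)"
  then show "expectation (\<lambda>\<omega>. (\<Sum>t\<in>J. c t * Y (a + t) \<omega>)\<^sup>2) = expectation (\<lambda>\<omega>. (\<Sum>t\<in>J. c t * Y t \<omega>)\<^sup>2)"
    by (simp add: second_moment_sum[of J c "\<lambda>t. a + t"] second_moment_sum[of J c "\<lambda>t. t"])
qed

lemma increments_gaussian: "gaussian_family M I (\<lambda>t \<omega>. Y (a + t) \<omega> - Y a \<omega>)"
  unfolding gaussian_family_def
proof (intro allI impI)
  fix J :: "real set" and c :: "real \<Rightarrow> real" assume J: "finite J"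
  \<comment> \<open>Each increment is split into two terms, told apart by a boolean:
    \<open>True\<close> for the end point, \<open>False\<close> for the base time
    \<open>a\<close>.\<close>
  have "(\<Sum>j\<in>J \<times> UNIV. (if snd j then c (fst j) else - c (fst j)) * Y (if snd j then a + fst j else a) \<omega>)
    = (\<Sum>t\<in>J. c t * (Y (a + t) \<omega> - Y a \<omega>))" for \<omega>
    by (subst sum.cartesian_product') (simp add: UNIV_bool algebra_simps)
  then show "centered_gaussian_rv M (\<lambda>\<omega>. \<Sum>t\<in>J. c t * (Y (a + t) \<omega> - Y a \<omega>))"
    using gaussian_family_reindex[OF gaussian, of "J \<times> UNIV" "\<lambda>j. if snd j then a + fst j else a"
        "\<lambda>j. if snd j then c (fst j) else - c (fst j)"] J by simp
qed

text \<open>As \<open>D\<close> is countable, the event is measurable for the product sigma-algebra,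
  so that it has the same probability under the shifted law.\<close>

lemma oscillation_stationary:
  assumes "countable D"
  shows "prob {\<omega>\<in>space M. \<exists>t\<in>D. \<bar>Y (a + t) \<omega> - Y a \<omega>\<bar> > s} = prob {\<omega>\<in>space M. \<exists>t\<in>D. \<bar>Y t \<omega> - Y 0 \<omega>\<bar> > s}"
proof -
  define E where "E = {f\<in>space (Pi\<^sub>M UNIV (\<lambda>_. borel)). \<exists>t\<in>D. \<bar>f t - f (0::real)\<bar> > (s::real)}"
  have E: "E \<in> sets (Pi\<^sub>M UNIV (\<lambda>_. borel))"
    unfolding E_def using assms by measurable
  have m: "(\<lambda>\<omega>. \<lambda>t\<in>UNIV. Y (b + t) \<omega>) \<in> M \<rightarrow>\<^sub>M Pi\<^sub>M UNIV (\<lambda>_. borel)" for b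
    by (rule measurable_restrict) simp
  have "prob ((\<lambda>\<omega>. \<lambda>t\<in>UNIV. Y (a + t) \<omega>) -` E \<inter> space M) = prob ((\<lambda>\<omega>. \<lambda>t\<in>UNIV. Y (0 + t) \<omega>) -` E \<inter> space M)"
    using arg_cong[OF shift_invariant_law, of "\<lambda>K. measure K E" a]
      measure_distr[OF m E, of a] measure_distr[OF m E, of 0] by (simp del: restrict_apply restrict_UNIV)
  then show ?thesis
    by (simp add: E_def space_PiM vimage_def Int_def conj_commute)
qed

text \<open>The events for \<open>\<delta> = 1 / Suc n\<close> decrease, and continuity at 0 makes
  their intersection empty. The bound 1/4 is the input of \<open>fernique_tail\<close>.\<close>

lemma small_oscillation:
  assumes "s > 0"
  obtains \<delta> where "\<delta> > 0" "prob {\<omega>\<in>space M. \<exists>t\<in>\<rat> \<inter> {0..\<delta>}. \<bar>Y t \<omega> - Y 0 \<omega>\<bar> > s} \<le> 1/4"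
proof -
  define A where "A n = {\<omega>\<in>space M. \<exists>t\<in>\<rat> \<inter> {0..1 / Suc n}. \<bar>Y t \<omega> - Y 0 \<omega>\<bar> > s}" for n
  have ctbl: "countable (\<rat> \<inter> B :: real set)" for B
    using countable_rat by (rule countable_subset[rotated]) auto
  have "A n \<in> sets M" for n
    unfolding A_def using ctbl by measurable
  moreover have "decseq A"
  proof (rule decseq_SucI)
    fix n
    have "1 / real (Suc (Suc n)) \<le> 1 / real (Suc n)" by (simp add: field_simps)
    then have "{0..1 / real (Suc (Suc n))} \<subseteq> {0..1 / real (Suc n)}" by simp
    then show "A (Suc n) \<subseteq> A n" unfolding A_def by blast
  qed
  ultimately have "(\<lambda>n. prob (A n)) \<longlonglongrightarrow> prob (\<Inter>n. A n)"
    by (intro finite_Lim_measure_decseq) auto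
  moreover have "(\<Inter>n. A n) = {}"
  proof (rule ccontr)
    assume "(\<Inter>n. A n) \<noteq> {}"
    then obtain \<omega> where \<omega>: "\<And>n. \<omega> \<in> A n" by blast
    then have "isCont (\<lambda>u. Y u \<omega>) 0"
      using paths[of \<omega>] by (auto simp: A_def continuous_on_eq_continuous_at)
    then obtain d where d: "d > 0" "\<And>u. \<bar>u\<bar> < d \<Longrightarrow> \<bar>Y u \<omega> - Y 0 \<omega>\<bar> < s"
      using \<open>s > 0\<close> by (auto simp: continuous_at_eps_delta dist_real_def)
    obtain n where n: "1 / Suc n < d"
      using reals_Archimedean[OF \<open>d > 0\<close>] by (auto simp: inverse_eq_divide)
    obtain t where "t \<in> {0..1 / Suc n}" "\<bar>Y t \<omega> - Y 0 \<omega>\<bar> > s"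
      using \<omega>[of n] by (auto simp: A_def)
    then show False using d(2)[of t] n by auto
  qed
  ultimately have "eventually (\<lambda>n. prob (A n) < 1/4) sequentially"
    using order_tendstoD(2)[of "\<lambda>n. prob (A n)" 0 sequentially "1/4"] by simp
  then obtain n where "prob (A n) < 1/4"
    by (auto simp: eventually_sequentially)
  then show ?thesis
    using that[of "1 / Suc n"] by (simp add: A_def)
qed

lemma upper_bound:
  assumes "\<epsilon> > 0"
  shows "AE \<omega> in M. eventually (\<lambda>u. Y u \<omega> \<le> (sqrt (r 0) + \<epsilon>) * sqrt (2 * ln u)) at_top"
proof -
  define \<sigma> e where "\<sigma> = sqrt (r 0)" and "e = \<epsilon> / 2"
  have \<sigma>: "\<sigma> \<ge> 0" "\<sigma>\<^sup>2 = r 0" using r0_nonneg by (auto simp: \<sigma>_def)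
  have e: "e > 0" using assms by (simp add: e_def)
  \<comment> \<open>One half of \<open>\<epsilon>\<close> is for the grid and one for the
    oscillation. With \<open>e / 8\<close>, the bound \<open>a\<^sup>2 / (32 * s\<^sup>2)\<close> of
    \<open>fernique_tail\<close> becomes \<open>4 * ln (a j)\<close>, a summable fourth
    power.\<close>
  obtain \<delta> where \<delta>: "\<delta> > 0" and osc: "prob {\<omega>\<in>space M. \<exists>t\<in>\<rat> \<inter> {0..\<delta>}. \<bar>Y t \<omega> - Y 0 \<omega>\<bar> > e / 8} \<le> 1/4"
    using small_oscillation[of "e / 8"] e by auto
  define D where "D = \<rat> \<inter> {0..\<delta>}"
  have D: "countable D" unfolding D_def using countable_rat by (rule countable_subset[rotated]) auto
  define a where "a j = \<delta> * real j" for j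
  define A where "A j = {\<omega>\<in>space M. Y (a j) \<omega> > (\<sigma> + e) * sqrt (2 * ln (a j))}" for j
  define B where "B j = {\<omega>\<in>space M. \<exists>t\<in>D. \<bar>Y (a j + t) \<omega> - Y (a j) \<omega>\<bar> > e * sqrt (2 * ln (a j))}" for j
  have [measurable]: "A j \<in> sets M" "B j \<in> sets M" for j
    unfolding A_def B_def using D by measurable
  \<comment> \<open>Then \<open>ln (a j) \<ge> 1\<close>, so that
    \<open>e * sqrt (2 * ln (a j))\<close> is above the threshold \<open>4 * (e / 8)\<close> of
    \<open>fernique_tail\<close>.\<close>
  have large: "eventually (\<lambda>j. a j \<ge> exp 1) sequentially"
    unfolding a_def using \<delta> by real_asymp
  \<comment> \<open>The variance is bounded by \<open>(\<sigma> + e / 2)\<^sup>2\<close>, which is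
    positive even if \<open>\<sigma> = 0\<close> and still leaves an exponent above 1.\<close>
  define \<kappa> where "\<kappa> = (\<sigma> + e)\<^sup>2 / (\<sigma> + e / 2)\<^sup>2"
  have "\<kappa> > 1"
    using e \<sigma> by (simp add: \<kappa>_def power_strict_mono)
  have "eventually (\<lambda>j. norm (prob (A j)) \<le> \<delta> powr (-\<kappa>) * real j powr (-\<kappa>)) sequentially"
    using large
  proof eventually_elim
    case (elim j)
    then have pos: "a j > 0" "ln (a j) \<ge> 1"
      using less_le_trans[OF exp_gt_zero elim] ln_ge_iff by auto
    have sq: "(sqrt (2 * ln (a j)))\<^sup>2 = 2 * ln (a j)"
      using pos by (intro real_sqrt_pow2) linarith
    have "prob (A j) \<le> exp (- ((\<sigma> + e) * sqrt (2 * ln (a j)))\<^sup>2 / (2 * (\<sigma> + e / 2)\<^sup>2))"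
      unfolding A_def
    proof (rule centered_gaussian_rv_tail[OF prob_space_axioms gaussian_rv])
      show "expectation (\<lambda>\<omega>. (Y (a j) \<omega>)\<^sup>2) \<le> (\<sigma> + e / 2)\<^sup>2"
        using \<sigma> e by (simp add: second_moment flip: \<sigma>(2))
    qed (use \<sigma> e pos in \<open>auto intro!: mult_pos_pos simp: ln_gt_zero_imp_gt_one\<close>)
    also have "- ((\<sigma> + e) * sqrt (2 * ln (a j)))\<^sup>2 / (2 * (\<sigma> + e / 2)\<^sup>2) = - \<kappa> * ln (a j)"
      unfolding power_mult_distrib sq \<kappa>_def by simp
    also have "exp \<dots> = a j powr (-\<kappa>)"
      unfolding powr_def using pos(1) by simp
    also have "\<dots> = \<delta> powr (-\<kappa>) * real j powr (-\<kappa>)"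
      using \<delta> by (simp add: a_def powr_mult)
    finally show ?case by simp
  qed
  then have "summable (\<lambda>j. prob (A j))"
    by (rule summable_comparison_test_ev) (use \<open>\<kappa> > 1\<close> in \<open>simp add: summable_mult summable_real_powr_iff\<close>)
  then have AE_A: "AE \<omega> in M. eventually (\<lambda>j. \<omega> \<in> space M - A j) sequentially"
    by (intro borel_cantelli_AE1) (simp_all add: emeasure_eq_measure)
  have "eventually (\<lambda>j. norm (prob (B j)) \<le> \<delta> powr (-4) * real j powr (-4)) sequentially"
    using large
  proof eventually_elim
    case (elim j)
    then have pos: "a j > 0" "ln (a j) \<ge> 1"
      using less_le_trans[OF exp_gt_zero elim] ln_ge_iff by auto
    have sq: "(sqrt (2 * ln (a j)))\<^sup>2 = 2 * ln (a j)"
      using pos by (intro real_sqrt_pow2) linarith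
    have "1 \<le> sqrt (2 * ln (a j))" using pos by simp
    then have ge: "4 * (e / 8) \<le> e * sqrt (2 * ln (a j))" using mult_left_mono[of 1 "sqrt (2 * ln (a j))" e] e by linarith
    have "prob (B j) \<le> exp (- (e * sqrt (2 * ln (a j)))\<^sup>2 / (32 * (e / 8)\<^sup>2))"
      unfolding B_def
    proof (rule fernique_tail[OF prob_space_axioms increments_gaussian D])
      show "prob {\<omega>\<in>space M. \<exists>t\<in>D. \<bar>Y (a j + t) \<omega> - Y (a j) \<omega>\<bar> > e / 8} \<le> 1/4"
        using osc oscillation_stationary[OF D, of "e / 8" "a j"] by (simp only: D_def)
      show "e / 8 > 0" using e by simp
    qed (rule ge)
    also have "- (e * sqrt (2 * ln (a j)))\<^sup>2 / (32 * (e / 8)\<^sup>2) = - 4 * ln (a j)"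
      unfolding power_mult_distrib sq using e by (simp add: power_divide)
    also have "exp \<dots> = a j powr (-4)"
      unfolding powr_def using pos(1) by simp
    also have "\<dots> = \<delta> powr (-4) * real j powr (-4)"
      using \<delta> by (simp add: a_def powr_mult)
    finally show ?case by simp
  qed
  then have "summable (\<lambda>j. prob (B j))"
    by (rule summable_comparison_test_ev) (simp add: summable_mult summable_real_powr_iff del: powr_minus)
  then have AE_B: "AE \<omega> in M. eventually (\<lambda>j. \<omega> \<in> space M - B j) sequentially"
    by (intro borel_cantelli_AE1) (simp_all add: emeasure_eq_measure)
  show ?thesis
    using AE_A AE_B
  proof (eventually_elim)
    case (elim \<omega>)
    obtain n where n: "\<And>j. j \<ge> n \<Longrightarrow> a j \<ge> exp 1 \<and> \<omega> \<in> space M - A j \<and> \<omega> \<in> space M - B j"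
      using eventually_conj[OF large eventually_conj[OF elim]] by (auto simp: eventually_sequentially)
    show ?case
      using eventually_ge_at_top[of "\<delta> * (real n + 1)"]
    proof eventually_elim
      case (elim u)
      define j where "j = nat \<lfloor>u / \<delta>\<rfloor>"
      have ud: "u / \<delta> \<ge> real n + 1" using elim \<delta> by (simp add: field_simps)
      then have j: "real j \<le> u / \<delta>" "u / \<delta> < real j + 1" "j \<ge> n"
        unfolding j_def by linarith+
      define t where "t = u - a j"
      have t: "t \<in> {0..\<delta>}" using j \<delta> by (simp add: t_def a_def field_simps)
      have \<omega>: "\<omega> \<in> space M" using n[OF j(3)] by auto
      have "a j > 0" using less_le_trans[OF exp_gt_zero] n[OF j(3)] by blast
      have "\<bar>Y (a j + t) \<omega> - Y (a j) \<omega>\<bar> \<le> e * sqrt (2 * ln (a j))"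
      proof (rule le_on_rationals_imp_le[OF _ \<delta> _ t])
        show "continuous_on UNIV (\<lambda>t. \<bar>Y (a j + t) \<omega> - Y (a j) \<omega>\<bar>)"
          by (intro continuous_intros continuous_on_compose2[OF paths[OF \<omega>]]) auto
        show "\<bar>Y (a j + x) \<omega> - Y (a j) \<omega>\<bar> \<le> e * sqrt (2 * ln (a j))" if "x \<in> \<rat> \<inter> {0..\<delta>}" for x
          using n[OF j(3)] that unfolding B_def D_def by force
      qed
      moreover have "Y (a j) \<omega> \<le> (\<sigma> + e) * sqrt (2 * ln (a j))"
        using n[OF j(3)] unfolding A_def by auto
      moreover have "e * sqrt (2 * ln (a j)) + (\<sigma> + e) * sqrt (2 * ln (a j)) = (\<sigma> + \<epsilon>) * sqrt (2 * ln (a j))"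
        by (simp add: e_def algebra_simps)
      moreover have "a j + t = u" by (simp add: t_def)
      ultimately have "Y u \<omega> \<le> (\<sigma> + \<epsilon>) * sqrt (2 * ln (a j))"
        by simp
      also have "\<dots> \<le> (\<sigma> + \<epsilon>) * sqrt (2 * ln u)"
      proof (rule mult_left_mono)
        have "ln (a j) \<le> ln u" using t \<open>a j > 0\<close> by (intro ln_mono) (auto simp: t_def)
        then show "sqrt (2 * ln (a j)) \<le> sqrt (2 * ln u)" by simp
        show "0 \<le> \<sigma> + \<epsilon>" using \<sigma> assms by simp
      qed
      finally show ?case by (simp add: \<sigma>_def)
    qed
  qed
qed

end

section \<open>Stationary Gaussian processes: lower bound\<close>

context stationary_gaussian
begin

section \<open>Exponential moments and truncated tilts\<close>

lemma mgf: "integrable M (\<lambda>\<omega>. exp (a * Y u \<omega>))" "expectation (\<lambda>\<omega>. exp (a * Y u \<omega>)) = exp (a\<^sup>2 * r 0 / 2)"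
  using centered_gaussian_rv_mgf[OF prob_space_axioms gaussian_rv] by (simp_all add: second_moment)

lemma mgf_pair:
  "integrable M (\<lambda>\<omega>. exp (a * (Y u \<omega> + Y w \<omega>)))"
  "expectation (\<lambda>\<omega>. exp (a * (Y u \<omega> + Y w \<omega>))) = exp (a\<^sup>2 * (r 0 + r \<bar>u - w\<bar>))"
proof -
  have g: "centered_gaussian_rv M (\<lambda>\<omega>. Y u \<omega> + Y w \<omega>)"
    using gaussian_family_two[OF gaussian, of u w 1 1] by simp
  have "(Y u \<omega> + Y w \<omega>)\<^sup>2 = Y u \<omega> * Y u \<omega> + Y w \<omega> * Y w \<omega> + 2 * (Y u \<omega> * Y w \<omega>)" for \<omega>
    by (simp add: power2_eq_square algebra_simps)
  then have "expectation (\<lambda>\<omega>. (Y u \<omega> + Y w \<omega>)\<^sup>2) = 2 * (r 0 + r \<bar>u - w\<bar>)"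
    using integrable_Y_mult by (simp add: covariance)
  then show "integrable M (\<lambda>\<omega>. exp (a * (Y u \<omega> + Y w \<omega>)))"
    "expectation (\<lambda>\<omega>. exp (a * (Y u \<omega> + Y w \<omega>))) = exp (a\<^sup>2 * (r 0 + r \<bar>u - w\<bar>))"
    using centered_gaussian_rv_mgf[OF prob_space_axioms g, of a] by simp_all
qed

text \<open>The exponential tilt moves the mean of \<open>Y u\<close> from 0 to \<open>\<tau> * r 0\<close>. Without truncation
  to a window around the new mean the second moment would be too large for Chebyshev's inequality.\<close>

definition tilt :: "real \<Rightarrow> real \<Rightarrow> real \<Rightarrow> real" where
  "tilt \<tau> e x = exp (\<tau> * x - \<tau>\<^sup>2 * r 0 / 2) * indicator {(1 - e) * \<tau> * r 0 .. (1 + e) * \<tau> * r 0} x"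

lemma tilt_measurable [measurable]: "tilt \<tau> e \<in> borel_measurable borel"
  unfolding tilt_def[abs_def] by measurable

lemma tilt_nonneg: "tilt \<tau> e x \<ge> 0"
  by (simp add: tilt_def)

lemma tilt_le_exp: "tilt \<tau> e x \<le> exp (\<tau> * x - \<tau>\<^sup>2 * r 0 / 2)"
  by (simp add: tilt_def indicator_def)

lemma tilt_integrable: "integrable M (\<lambda>\<omega>. tilt \<tau> e (Y u \<omega>))"
proof (rule Bochner_Integration.integrable_bound)
  show "integrable M (\<lambda>\<omega>. exp (\<tau> * Y u \<omega>) / exp (\<tau>\<^sup>2 * r 0 / 2))"
    using mgf by simp
  show "AE \<omega> in M. norm (tilt \<tau> e (Y u \<omega>)) \<le> norm (exp (\<tau> * Y u \<omega>) / exp (\<tau>\<^sup>2 * r 0 / 2))"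
    using tilt_nonneg tilt_le_exp by (auto simp: exp_diff)
qed simp

text \<open>The untruncated tilt has mean 1. The mass lost on either side of the window is bounded
  as in Chernoff's inequality for the tilted law, by a further tilt with parameter
  \<open>e * \<tau>\<close> upwards or downwards.\<close>

lemma tilt_expectation_ge:
  assumes "\<tau> > 0" "e > 0"
  shows "expectation (\<lambda>\<omega>. tilt \<tau> e (Y u \<omega>)) \<ge> 1 - 2 * exp (- e\<^sup>2 * \<tau>\<^sup>2 * r 0 / 2)"
proof -
  define v where "v = r 0"
  define c where "c = \<tau>\<^sup>2 * v / 2"
  \<comment> \<open>\<open>f\<close> and \<open>g\<close> are the tilted density times an
    exponential that is at least 1 above, respectively below, the window; the identities
    \<open>f\<close> and \<open>g\<close> in the proof of \<open>pt\<close> show this form.\<close>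
  define f where "f x = exp (\<tau> * (1 + e) * x) * exp (- c - e * \<tau>\<^sup>2 * v - e\<^sup>2 * \<tau>\<^sup>2 * v)" for x
  define g where "g x = exp (\<tau> * (1 - e) * x) * exp (- c + e * \<tau>\<^sup>2 * v - e\<^sup>2 * \<tau>\<^sup>2 * v)" for x
  have pt: "exp (\<tau> * x) * exp (- c) \<le> tilt \<tau> e x + f x + g x" for x
  proof -
    have f: "f x = exp (\<tau> * x - c + e * \<tau> * (x - (1 + e) * \<tau> * v))"
      unfolding f_def exp_add[symmetric] by (rule arg_cong[where f = exp]) (simp add: algebra_simps power2_eq_square)
    have g: "g x = exp (\<tau> * x - c + e * \<tau> * ((1 - e) * \<tau> * v - x))"
      unfolding g_def exp_add[symmetric] by (rule arg_cong[where f = exp]) (simp add: algebra_simps power2_eq_square)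
    have pos: "f x \<ge> 0" "g x \<ge> 0" by (simp_all add: f_def g_def)
    have E: "exp (\<tau> * x) * exp (- c) = exp (\<tau> * x - c)" by (simp add: exp_diff exp_minus divide_inverse)
    have el: "e * \<tau> > 0" using assms by simp
    consider "x > (1 + e) * \<tau> * v" | "x < (1 - e) * \<tau> * v" | "(1 - e) * \<tau> * v \<le> x" "x \<le> (1 + e) * \<tau> * v"
      by linarith
    then show ?thesis
    proof cases
      case 1
      then have "e * \<tau> * (x - (1 + e) * \<tau> * v) \<ge> 0"
        using el mult_nonneg_nonneg[of "e * \<tau>" "x - (1 + e) * \<tau> * v"] by linarith
      then have "exp (\<tau> * x - c) \<le> f x" unfolding f by simp
      then show ?thesis unfolding E using pos tilt_nonneg[of \<tau> e x] by linarith
    next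
      case 2
      then have "e * \<tau> * ((1 - e) * \<tau> * v - x) \<ge> 0"
        using el mult_nonneg_nonneg[of "e * \<tau>" "(1 - e) * \<tau> * v - x"] by linarith
      then have "exp (\<tau> * x - c) \<le> g x" unfolding g by simp
      then show ?thesis unfolding E using pos tilt_nonneg[of \<tau> e x] by linarith
    next
      case 3
      then have "tilt \<tau> e x = exp (\<tau> * x - c)" by (simp add: tilt_def v_def c_def)
      then show ?thesis unfolding E using pos by linarith
    qed
  qed
  have int: "integrable M (\<lambda>\<omega>. f (Y u \<omega>))" "integrable M (\<lambda>\<omega>. g (Y u \<omega>))"
    unfolding f_def g_def by (intro integrable_mult_left mgf)+
  have Ef: "expectation (\<lambda>\<omega>. f (Y u \<omega>)) = exp (- e\<^sup>2 * \<tau>\<^sup>2 * v / 2)"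
    unfolding f_def integral_mult_left_zero mgf(2) unfolding exp_add[symmetric]
    by (rule arg_cong[where f = exp]) (simp add: v_def c_def field_simps power2_eq_square)
  have Eg: "expectation (\<lambda>\<omega>. g (Y u \<omega>)) = exp (- e\<^sup>2 * \<tau>\<^sup>2 * v / 2)"
    unfolding g_def integral_mult_left_zero mgf(2) unfolding exp_add[symmetric]
    by (rule arg_cong[where f = exp]) (simp add: v_def c_def field_simps power2_eq_square)
  have "1 = expectation (\<lambda>\<omega>. exp (\<tau> * Y u \<omega>) * exp (- c))"
    unfolding integral_mult_left_zero mgf(2) unfolding exp_add[symmetric] by (simp add: c_def v_def)
  also have "\<dots> \<le> expectation (\<lambda>\<omega>. tilt \<tau> e (Y u \<omega>) + f (Y u \<omega>) + g (Y u \<omega>))"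
    by (intro integral_mono Bochner_Integration.integrable_add int tilt_integrable integrable_mult_left mgf pt)
  also have "\<dots> = expectation (\<lambda>\<omega>. tilt \<tau> e (Y u \<omega>)) + 2 * exp (- e\<^sup>2 * \<tau>\<^sup>2 * v / 2)"
    using int tilt_integrable Ef Eg by simp
  finally show ?thesis by (simp add: v_def)
qed

lemma tilt_mult_integrable: "integrable M (\<lambda>\<omega>. tilt \<tau> e (Y u \<omega>) * tilt \<tau> e (Y w \<omega>))"
  and tilt_mult_le: "expectation (\<lambda>\<omega>. tilt \<tau> e (Y u \<omega>) * tilt \<tau> e (Y w \<omega>)) \<le> exp (\<tau>\<^sup>2 * r \<bar>u - w\<bar>)"
proof -
  have le: "tilt \<tau> e x * tilt \<tau> e y \<le> exp (\<tau> * (x + y)) * exp (- \<tau>\<^sup>2 * r 0)" for x y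
  proof -
    have "tilt \<tau> e x * tilt \<tau> e y \<le> exp (\<tau> * x - \<tau>\<^sup>2 * r 0 / 2) * exp (\<tau> * y - \<tau>\<^sup>2 * r 0 / 2)"
      by (intro mult_mono tilt_le_exp tilt_nonneg) simp
    then show ?thesis by (simp only: exp_add[symmetric]) (simp add: algebra_simps)
  qed
  have int: "integrable M (\<lambda>\<omega>. exp (\<tau> * (Y u \<omega> + Y w \<omega>)) * exp (- \<tau>\<^sup>2 * r 0))"
    by (intro integrable_mult_left mgf_pair)
  show *: "integrable M (\<lambda>\<omega>. tilt \<tau> e (Y u \<omega>) * tilt \<tau> e (Y w \<omega>))"
    by (rule Bochner_Integration.integrable_bound[OF int]) (use le tilt_nonneg in \<open>auto simp: abs_mult\<close>)
  have "expectation (\<lambda>\<omega>. tilt \<tau> e (Y u \<omega>) * tilt \<tau> e (Y w \<omega>)) \<le> expectation (\<lambda>\<omega>. exp (\<tau> * (Y u \<omega> + Y w \<omega>)) * exp (- \<tau>\<^sup>2 * r 0))"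
    by (intro integral_mono int le *)
  also have "\<dots> = exp (\<tau>\<^sup>2 * r \<bar>u - w\<bar>)"
    unfolding integral_mult_left_zero mgf_pair(2) unfolding exp_add[symmetric]
    by (rule arg_cong[where f = exp]) (simp add: algebra_simps)
  finally show "expectation (\<lambda>\<omega>. tilt \<tau> e (Y u \<omega>) * tilt \<tau> e (Y w \<omega>)) \<le> exp (\<tau>\<^sup>2 * r \<bar>u - w\<bar>)" .
qed

text \<open>The upper end of the window bounds one of the two factors
  \<open>exp (\<tau> * x)\<close>. This replaces the exponent \<open>\<tau>\<^sup>2 * r 0\<close> of
  the untruncated square by about half of it, which is affordable on the diagonal when
  \<open>\<tau>\<^sup>2 * r 0\<close> is slightly below \<open>2 * ln n\<close>.\<close>

lemma tilt_square_le:
  assumes "\<tau> > 0"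
  shows "expectation (\<lambda>\<omega>. tilt \<tau> e (Y u \<omega>) * tilt \<tau> e (Y u \<omega>)) \<le> exp ((1 / 2 + e) * \<tau>\<^sup>2 * r 0)"
proof -
  define v where "v = r 0"
  have le: "tilt \<tau> e x * tilt \<tau> e x \<le> exp (\<tau> * x) * exp (e * \<tau>\<^sup>2 * v)" for x
  proof (cases "x \<in> {(1 - e) * \<tau> * v .. (1 + e) * \<tau> * v}")
    case True
    then have "\<tau> * x \<le> \<tau> * ((1 + e) * \<tau> * v)" using assms by simp
    then have "2 * (\<tau> * x - \<tau>\<^sup>2 * v / 2) \<le> \<tau> * x + e * \<tau>\<^sup>2 * v" by (simp add: algebra_simps power2_eq_square)
    moreover have "tilt \<tau> e x * tilt \<tau> e x = exp (2 * (\<tau> * x - \<tau>\<^sup>2 * v / 2))"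
      using True by (simp add: tilt_def v_def flip: exp_add)
    ultimately show ?thesis by (simp flip: exp_add)
  next
    case False
    then have "tilt \<tau> e x = 0" by (simp add: tilt_def v_def)
    then show ?thesis by simp
  qed
  have "expectation (\<lambda>\<omega>. tilt \<tau> e (Y u \<omega>) * tilt \<tau> e (Y u \<omega>)) \<le> expectation (\<lambda>\<omega>. exp (\<tau> * Y u \<omega>) * exp (e * \<tau>\<^sup>2 * v))"
    by (intro integral_mono tilt_mult_integrable integrable_mult_left mgf le)
  also have "\<dots> = exp ((1 / 2 + e) * \<tau>\<^sup>2 * v)"
    unfolding integral_mult_left_zero mgf(2) unfolding exp_add[symmetric]
    by (rule arg_cong[where f = exp]) (simp add: v_def algebra_simps)
  finally show ?thesis by (simp add: v_def)
qed

text \<open>If all points are below the window, the sum \<open>S\<close> of tilts vanishes and so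
  deviates from its mean by the mean itself; Chebyshev's inequality bounds this. The hypothesis on
  1/4 gives mean at least \<open>n / 2\<close>, whence the factor 4.\<close>

lemma second_moment_bound:
  assumes \<tau>: "\<tau> > 0" and e: "e > 0" and n: "n > 0" and m: "m > 0"
    and b: "\<And>u. u \<ge> m \<Longrightarrow> r u \<le> b" and q: "exp (- e\<^sup>2 * \<tau>\<^sup>2 * r 0 / 2) \<le> 1 / 4"
  shows "prob {\<omega>\<in>space M. \<forall>j\<in>{1..n}. Y (real j * m) \<omega> < (1 - e) * \<tau> * r 0}
    \<le> 4 * (exp (\<tau>\<^sup>2 * b) - 1 + exp ((1 / 2 + e) * \<tau>\<^sup>2 * r 0) / real n + 4 * exp (- e\<^sup>2 * \<tau>\<^sup>2 * r 0 / 2))"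
proof -
  define q where "q = exp (- e\<^sup>2 * \<tau>\<^sup>2 * r 0 / 2)"
  define G where "G j \<omega> = tilt \<tau> e (Y (real j * m) \<omega>)" for j \<omega>
  define S where "S \<omega> = (\<Sum>j\<in>{1..n}. G j \<omega>)" for \<omega>
  define D where "D = exp ((1 / 2 + e) * \<tau>\<^sup>2 * r 0)"
  have [measurable]: "G j \<in> borel_measurable M" for j unfolding G_def by measurable
  have [measurable]: "S \<in> borel_measurable M" unfolding S_def by measurable
  have intG: "integrable M (G j)" "integrable M (\<lambda>\<omega>. G i \<omega> * G j \<omega>)" for i j
    unfolding G_def by (rule tilt_integrable tilt_mult_integrable)+
  have S2: "(S \<omega>)\<^sup>2 = (\<Sum>i\<in>{1..n}. \<Sum>j\<in>{1..n}. G i \<omega> * G j \<omega>)" for \<omega>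
    by (simp add: S_def power2_eq_square sum_product)
  have intS: "integrable M S" "integrable M (\<lambda>\<omega>. (S \<omega>)\<^sup>2)"
    unfolding S2 unfolding S_def using intG by auto
  have "real n * (1 - 2 * q) = (\<Sum>j\<in>{1..n}. 1 - 2 * q)" by simp
  also have "\<dots> \<le> (\<Sum>j\<in>{1..n}. expectation (G j))"
    unfolding G_def q_def by (intro sum_mono tilt_expectation_ge \<tau> e)
  also have "\<dots> = expectation S" unfolding S_def using intG by simp
  finally have mu: "real n * (1 - 2 * q) \<le> expectation S" .
  have q4: "0 \<le> q" "q \<le> 1 / 4" using q by (auto simp: q_def)
  have half: "real n / 2 \<le> real n * (1 - 2 * q)" using q4 mult_left_mono[of "1 / 2" "1 - 2 * q" "real n"] by simp
  have mupos: "expectation S \<ge> real n / 2" using half mu by (rule order_trans)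
  have "expectation (\<lambda>\<omega>. (S \<omega>)\<^sup>2) = (\<Sum>i\<in>{1..n}. \<Sum>j\<in>{1..n}. expectation (\<lambda>\<omega>. G i \<omega> * G j \<omega>))"
    unfolding S2 using intG by simp
  \<comment> \<open>On the diagonal the first summand is surplus; it completes the double sum to
    \<open>n\<^sup>2\<close> equal terms, which nearly cancel against the squared mean.\<close>
  also have "\<dots> \<le> (\<Sum>i\<in>{1..n}. \<Sum>j\<in>{1..n}. exp (\<tau>\<^sup>2 * b) + (if i = j then D else 0))"
  proof (intro sum_mono)
    fix i j :: nat
    show "expectation (\<lambda>\<omega>. G i \<omega> * G j \<omega>) \<le> exp (\<tau>\<^sup>2 * b) + (if i = j then D else 0)"
    proof (cases "i = j")
      case True
      then show ?thesis
        using tilt_square_le[OF \<tau>, of e "real j * m"] unfolding G_def D_def by (auto intro!: add_increasing)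
    next
      case False
      then have "\<bar>real i - real j\<bar> \<ge> 1" by linarith
      then have "m * 1 \<le> m * \<bar>real i - real j\<bar>" using m by (intro mult_left_mono) auto
      also have "\<dots> = \<bar>real i * m - real j * m\<bar>" using m by (simp add: abs_mult left_diff_distrib[symmetric])
      finally have "\<tau>\<^sup>2 * r \<bar>real i * m - real j * m\<bar> \<le> \<tau>\<^sup>2 * b" using b by (intro mult_left_mono) auto
      then show ?thesis
        using False tilt_mult_le[of \<tau> e "real i * m" "real j * m"] unfolding G_def
        by (auto intro: order_trans)
    qed
  qed
  also have "\<dots> = (real n)\<^sup>2 * exp (\<tau>\<^sup>2 * b) + real n * D"
    by (simp add: sum.distrib power2_eq_square distrib_left mult.assoc)
  finally have ES2: "expectation (\<lambda>\<omega>. (S \<omega>)\<^sup>2) \<le> (real n)\<^sup>2 * exp (\<tau>\<^sup>2 * b) + real n * D" .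
  have "(real n)\<^sup>2 * (1 - 4 * q) \<le> (real n)\<^sup>2 * (1 - 2 * q)\<^sup>2"
    by (intro mult_left_mono) (auto simp: power2_eq_square algebra_simps)
  also have "\<dots> \<le> (expectation S)\<^sup>2"
    unfolding power_mult_distrib[symmetric] using mu q4 by (intro power_mono) auto
  finally have var: "variance S \<le> (real n)\<^sup>2 * (exp (\<tau>\<^sup>2 * b) - 1 + D / real n + 4 * q)"
    using ES2 n unfolding variance_eq[OF intS] by (simp add: algebra_simps power2_eq_square)
  have "prob {\<omega>\<in>space M. \<forall>j\<in>{1..n}. Y (real j * m) \<omega> < (1 - e) * \<tau> * r 0}
    \<le> prob {\<omega>\<in>space M. expectation S \<le> \<bar>S \<omega> - expectation S\<bar>}"
  proof (intro finite_measure_mono subsetI)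
    fix \<omega> assume "\<omega> \<in> {\<omega>\<in>space M. \<forall>j\<in>{1..n}. Y (real j * m) \<omega> < (1 - e) * \<tau> * r 0}"
    then have \<omega>: "\<omega> \<in> space M" and less: "\<And>j. j \<in> {1..n} \<Longrightarrow> Y (real j * m) \<omega> < (1 - e) * \<tau> * r 0"
      by auto
    have "S \<omega> = 0"
      unfolding S_def G_def tilt_def using less by (intro sum.neutral) (simp add: indicator_def not_le)
    with \<omega> show "\<omega> \<in> {\<omega>\<in>space M. expectation S \<le> \<bar>S \<omega> - expectation S\<bar>}" by simp
  qed simp
  also have "\<dots> \<le> variance S / (expectation S)\<^sup>2"
    using intS mupos n by (intro Chebyshev_inequality) auto
  also have "\<dots> \<le> variance S / (real n / 2)\<^sup>2"
    using mupos n by (intro divide_left_mono power_mono mult_pos_pos) auto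
  also have "\<dots> \<le> ((real n)\<^sup>2 * (exp (\<tau>\<^sup>2 * b) - 1 + D / real n + 4 * q)) / (real n / 2)\<^sup>2"
    using var by (intro divide_right_mono) auto
  also have "\<dots> = 4 * (exp (\<tau>\<^sup>2 * b) - 1 + D / real n + 4 * q)"
    using n by (simp add: power_divide)
  finally show ?thesis by (simp only: D_def q_def)
qed

end

text \<open>The three terms are the errors from covariances, from the diagonal and from truncation.
  In the first, \<open>exp x - 1\<close> is of order \<open>x\<close> near 0.\<close>

lemma summable_lower_bound_error:
  fixes A B c d :: real
  assumes "B > 0" "c > 0" "d > 0"
  shows "summable (\<lambda>k. 4 * (exp (A * real k * exp (- B * real k)) - 1 + exp (- c * real k) + 4 * exp (- d * real k)))"
proof (rule summable_comparison_test_bigo[where g = "\<lambda>k. inverse (real k ^ 2)"])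
  have s: "(\<lambda>k. exp (- x * real k)) \<in> O(\<lambda>k. inverse (real k ^ 2))" if "x > 0" for x :: real
    using that by real_asymp
  have e1: "(\<lambda>k. exp (A * real k * exp (- B * real k)) - 1) \<in> O(\<lambda>k. inverse (real k ^ 2))"
  proof -
    have "(\<lambda>x::real. exp x - 1) \<in> O[at 0](\<lambda>x. x)" by real_asymp
    \<comment> \<open>The point 0 is added because the inner function may vanish, as it does for
      \<open>A = 0\<close>; both sides are 0 there.\<close>
    then have "(\<lambda>x::real. exp x - 1) \<in> O[nhds 0](\<lambda>x. x)"
      by (auto simp: bigo_def eventually_at_filter elim!: eventually_mono)
    moreover have "((\<lambda>k. A * real k * exp (- B * real k)) \<longlongrightarrow> 0) sequentially"
    proof -
      have "((\<lambda>k. real k * exp (- B * real k)) \<longlongrightarrow> 0) sequentially" using assms by real_asymp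
      from tendsto_mult_left[OF this, of A] show ?thesis by (simp add: mult.assoc)
    qed
    ultimately have "(\<lambda>k. exp (A * real k * exp (- B * real k)) - 1) \<in> O(\<lambda>k. A * real k * exp (- B * real k))"
      by (rule landau_o.big.compose)
    also have "(\<lambda>k. A * real k * exp (- B * real k)) \<in> O(\<lambda>k. real k * exp (- B * real k))"
      by (simp add: mult.assoc)
    also have "(\<lambda>k. real k * exp (- B * real k)) \<in> O(\<lambda>k. inverse (real k ^ 2))"
      using assms by real_asymp
    finally show ?thesis .
  qed
  show "(\<lambda>k. 4 * (exp (A * real k * exp (- B * real k)) - 1 + exp (- c * real k) + 4 * exp (- d * real k))) \<in> O(\<lambda>k. inverse (real k ^ 2))"
    by (intro landau_o.big.cmult_in_iff[THEN iffD2] sum_in_bigo e1 s assms) simp_all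
  show "summable (\<lambda>k. norm (inverse (real k ^ 2)))"
    using inverse_power_summable[of 2, where 'a = real] by simp
qed

context stationary_gaussian
begin

lemma lower_bound_on_grid:
  assumes r0: "r 0 > 0" and \<eta>: "\<eta> > 0" and decay: "r \<in> O[at_top](\<lambda>u. u powr (-\<eta>))"
    and e: "0 < e" "e < 1 / 8"
  shows "AE \<omega> in M. eventually (\<lambda>k. \<exists>j\<in>{1..2^k}. Y (real j * exp (e * ln 2 * real k)) \<omega> \<ge>
    (1 - e) * sqrt (2 * (1 - 4 * e) * r 0 * (real k * ln 2))) sequentially"
proof -
  \<comment> \<open>With \<open>n = 2 ^ k\<close> this is \<open>m k = n powr e\<close>, and
    \<open>\<tau> k\<close> satisfies \<open>(\<tau> k)\<^sup>2 * r 0 = \<kappa> * k = 2 * (1 - 4 *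
    e) * ln n\<close>.\<close>
  define \<kappa> m where "\<kappa> = 2 * (1 - 4 * e) * ln 2" and "m k = exp (e * ln 2 * real k)" for k :: nat
  define \<tau> where "\<tau> k = sqrt (\<kappa> * real k / r 0)" for k
  define E where "E k = {\<omega>\<in>space M. \<forall>j\<in>{1..2^k}. Y (real j * m k) \<omega> < (1 - e) * \<tau> k * r 0}" for k :: nat
  have \<kappa>: "\<kappa> > 0" using e by (simp add: \<kappa>_def)
  have \<tau>2: "(\<tau> k)\<^sup>2 = \<kappa> * real k / r 0" for k
    unfolding \<tau>_def using \<kappa> r0 by (intro real_sqrt_pow2) simp
  have \<tau>v: "\<tau> k * r 0 = sqrt (2 * (1 - 4 * e) * r 0 * (real k * ln 2))" for k
  proof -
    have "\<tau> k * r 0 = sqrt (\<kappa> * real k / r 0) * sqrt ((r 0)\<^sup>2)" using r0 by (simp add: \<tau>_def)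
    also have "\<dots> = sqrt (\<kappa> * real k * r 0)"
      unfolding real_sqrt_mult[symmetric] using r0 by (simp add: power2_eq_square)
    finally show ?thesis by (simp add: \<kappa>_def mult_ac)
  qed
  have [measurable]: "E k \<in> sets M" for k unfolding E_def by measurable
  obtain C where C: "C > 0" and "eventually (\<lambda>u. norm (r u) \<le> C * norm (u powr (-\<eta>))) at_top"
    using decay by (rule landau_o.bigE)
  then obtain u0 where u0: "\<And>u. u \<ge> u0 \<Longrightarrow> r u \<le> C * u powr (-\<eta>)"
    by (fastforce simp: eventually_at_top_linorder)
  have b: "r u \<le> C * exp (- (\<eta> * e * ln 2) * real k)" if "u \<ge> m k" "m k \<ge> u0" for u k
  proof -
    have "r u \<le> C * u powr (-\<eta>)" using that by (intro u0) simp
    also have "\<dots> \<le> C * m k powr (-\<eta>)"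
      using that C \<eta> by (intro mult_left_mono powr_mono2') (auto simp: m_def)
    also have "m k powr (-\<eta>) = exp (- (\<eta> * e * ln 2) * real k)"
      by (simp add: m_def powr_def)
    finally show ?thesis .
  qed
  \<comment> \<open>\<open>A\<close> and \<open>B\<close> describe \<open>(\<tau> k)\<^sup>2\<close>
    times the covariance bound, and \<open>d\<close> the truncation. For the diagonal,
    \<open>(1/2 + e) * \<kappa> - ln 2 = - c\<close>.\<close>
  define A B c d where "A = \<kappa> * C / r 0" and "B = \<eta> * e * ln 2" and "c = (2 * e + 8 * e\<^sup>2) * ln 2"
    and "d = e\<^sup>2 * \<kappa> / 2"
  have pos: "B > 0" "c > 0" "d > 0" using \<eta> e \<kappa> by (simp_all add: B_def c_def d_def add_pos_pos)
  have q: "exp (- e\<^sup>2 * (\<tau> k)\<^sup>2 * r 0 / 2) = exp (- d * real k)" for k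
    unfolding \<tau>2 d_def using r0 by simp
  have "eventually (\<lambda>k. m k \<ge> u0) sequentially"
  proof -
    have "filterlim m at_top sequentially" unfolding m_def using e by real_asymp
    then show ?thesis by (simp add: filterlim_at_top)
  qed
  moreover have "eventually (\<lambda>k. exp (- d * real k) \<le> 1 / 4) sequentially"
  proof -
    have "((\<lambda>k. exp (- d * real k)) \<longlongrightarrow> 0) sequentially" using pos by real_asymp
    then have "eventually (\<lambda>k. exp (- d * real k) < 1 / 4) sequentially" by (rule order_tendstoD) simp
    then show ?thesis by (rule eventually_mono) simp
  qed
  ultimately have "eventually (\<lambda>k. norm (prob (E k)) \<le>
      4 * (exp (A * real k * exp (- B * real k)) - 1 + exp (- c * real k) + 4 * exp (- d * real k))) sequentially"
    using eventually_gt_at_top[of 0]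
  proof eventually_elim
    case (elim k)
    have tk: "\<tau> k > 0" unfolding \<tau>_def using elim \<kappa> r0 by simp
    have "prob (E k) \<le> 4 * (exp ((\<tau> k)\<^sup>2 * (C * exp (- (\<eta> * e * ln 2) * real k))) - 1 +
        exp ((1 / 2 + e) * (\<tau> k)\<^sup>2 * r 0) / real (2 ^ k) + 4 * exp (- e\<^sup>2 * (\<tau> k)\<^sup>2 * r 0 / 2))"
      unfolding E_def
    proof (rule second_moment_bound[OF tk e(1)])
      show "exp (- e\<^sup>2 * (\<tau> k)\<^sup>2 * r 0 / 2) \<le> 1 / 4" unfolding q by (rule elim)
    qed (use b elim in \<open>auto simp: m_def\<close>)
    also have "(\<tau> k)\<^sup>2 * (C * exp (- (\<eta> * e * ln 2) * real k)) = A * real k * exp (- B * real k)"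
      by (simp add: \<tau>2 A_def B_def)
    also have "exp ((1 / 2 + e) * (\<tau> k)\<^sup>2 * r 0) / real (2 ^ k) = exp ((1 / 2 + e) * \<kappa> * real k - real k * ln 2)"
    proof -
      have "real (2 ^ k) = exp (real k * ln 2)" by (simp add: exp_of_nat_mult)
      moreover have "(1 / 2 + e) * (\<tau> k)\<^sup>2 * r 0 = (1 / 2 + e) * \<kappa> * real k" using r0 by (simp add: \<tau>2)
      ultimately show ?thesis by (simp only: exp_diff)
    qed
    also have "(1 / 2 + e) * \<kappa> * real k - real k * ln 2 = - c * real k"
      by (simp add: \<kappa>_def c_def algebra_simps power2_eq_square)
    finally show ?case unfolding q by simp
  qed
  then have "summable (\<lambda>k. prob (E k))"
    using summable_lower_bound_error[OF pos] by (rule summable_comparison_test_ev)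
  then have "AE \<omega> in M. eventually (\<lambda>k. \<omega> \<in> space M - E k) sequentially"
    by (intro borel_cantelli_AE1) (simp_all add: emeasure_eq_measure)
  then show ?thesis
  proof eventually_elim
    case (elim \<omega>)
    then show ?case
    proof eventually_elim
      case (elim k)
      then show ?case
        unfolding E_def mult.assoc[of _ "\<tau> k"] \<tau>v by (auto simp: not_less m_def)
    qed
  qed
qed

text \<open>A grid point satisfies \<open>m k \<le> u \<le> n powr (1 + e)\<close> with
  \<open>n = 2 ^ k\<close>: it is arbitrarily late, and \<open>ln u\<close> exceeds
  \<open>ln n\<close> by at most the factor \<open>1 + e\<close>. The level found on the grid thus
  loses only a factor close to 1 against \<open>sqrt (2 * ln u)\<close>.\<close>

lemma lower_bound:
  assumes \<eta>: "\<eta> > 0" and decay: "r \<in> O[at_top](\<lambda>u. u powr (-\<eta>))" and "\<epsilon> > 0"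
  shows "AE \<omega> in M. frequently (\<lambda>u. Y u \<omega> \<ge> (sqrt (r 0) - \<epsilon>) * sqrt (2 * ln u)) at_top"
proof (cases "r 0 = 0")
  case True
  \<comment> \<open>The natural numbers are countable and unbounded, which suffices for a claim
    about arbitrarily late times; there the level is at most 0.\<close>
  have "AE \<omega> in M. Y (real n) \<omega> = 0" for n
  proof -
    have "AE \<omega> in M. (Y (real n) \<omega>)\<^sup>2 = 0"
      using integral_nonneg_eq_0_iff_AE[of M "\<lambda>\<omega>. (Y (real n) \<omega>)\<^sup>2"] second_moment[of "real n"] True
        integrable_Y_mult[of "real n" "real n"] by (simp add: power2_eq_square)
    then show ?thesis by simp
  qed
  then have "AE \<omega> in M. \<forall>n. Y (real n) \<omega> = 0" by (simp add: AE_all_countable)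
  then show ?thesis
  proof eventually_elim
    case (elim \<omega>)
    show ?case
      unfolding frequently_def
    proof
      assume "eventually (\<lambda>u. \<not> Y u \<omega> \<ge> (sqrt (r 0) - \<epsilon>) * sqrt (2 * ln u)) at_top"
      then obtain K where K: "\<And>u. u \<ge> K \<Longrightarrow> \<not> Y u \<omega> \<ge> - \<epsilon> * sqrt (2 * ln u)"
        using True by (auto simp: eventually_at_top_linorder)
      obtain n :: nat where n: "max 1 K \<le> real n" using real_arch_simple by blast
      then have "- \<epsilon> * sqrt (2 * ln (real n)) \<le> 0"
        using assms(3) by (auto intro!: mult_nonneg_nonneg)
      then show False using K[of "real n"] n elim by simp
    qed
  qed
next
  case False
  then have r0: "r 0 > 0" using r0_nonneg by simp
  define \<sigma> where "\<sigma> = sqrt (r 0)"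
  have \<sigma>: "\<sigma> > 0" using r0 by (simp add: \<sigma>_def)
  \<comment> \<open>The first bound keeps \<open>e\<close> below 1/8, the second makes the total
    loss \<open>6 * e * \<sigma>\<close> at most \<open>\<epsilon>\<close>.\<close>
  define e where "e = min (1 / 9) (\<epsilon> / (6 * \<sigma>))"
  have e: "0 < e" "e < 1 / 8" using \<sigma> assms(3) by (auto simp: e_def)
  have "e \<le> \<epsilon> / (6 * \<sigma>)" by (simp add: e_def)
  then have e\<epsilon>: "\<sigma> - \<epsilon> \<le> (1 - 6 * e) * \<sigma>" using \<sigma> by (simp add: field_simps)
  have key: "(1 - 6 * e) * sqrt (1 + e) \<le> (1 - e) * sqrt (1 - 4 * e)"
  proof (rule power2_le_imp_le)
    have "(1 - e)\<^sup>2 * (1 - 4 * e) - (1 - 6 * e)\<^sup>2 * (1 + e) = 5 * e * (1 - 3 * e - 8 * e\<^sup>2)"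
      by (simp add: power2_eq_square algebra_simps)
    moreover have "e\<^sup>2 \<le> e * (1 / 8)" unfolding power2_eq_square using e by (intro mult_left_mono) auto
    then have "1 - 3 * e - 8 * e\<^sup>2 \<ge> 0" using e by linarith
    then have "5 * e * (1 - 3 * e - 8 * e\<^sup>2) \<ge> 0" using e by (intro mult_nonneg_nonneg) auto
    ultimately show "((1 - 6 * e) * sqrt (1 + e))\<^sup>2 \<le> ((1 - e) * sqrt (1 - 4 * e))\<^sup>2"
      using e by (simp add: power_mult_distrib)
    show "0 \<le> (1 - e) * sqrt (1 - 4 * e)" using e by simp
  qed
  show ?thesis
    using lower_bound_on_grid[OF r0 \<eta> decay e]
  proof eventually_elim
    case (elim \<omega>)
    show ?case
      unfolding frequently_def
    proof
      assume "eventually (\<lambda>u. \<not> Y u \<omega> \<ge> (sqrt (r 0) - \<epsilon>) * sqrt (2 * ln u)) at_top"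
      then obtain K where K: "\<And>u. u \<ge> K \<Longrightarrow> Y u \<omega> < (\<sigma> - \<epsilon>) * sqrt (2 * ln u)"
        by (auto simp: eventually_at_top_linorder \<sigma>_def not_le)
      have "filterlim (\<lambda>k. exp (e * ln 2 * real k)) at_top sequentially" using e by real_asymp
      then have "eventually (\<lambda>k. exp (e * ln 2 * real k) \<ge> K) sequentially" by (simp add: filterlim_at_top)
      from eventually_happens[OF eventually_conj[OF this elim]] obtain k :: nat and j :: nat
        where k: "exp (e * ln 2 * real k) \<ge> K" and j: "1 \<le> j" "j \<le> 2 ^ k"
          and ge: "Y (real j * exp (e * ln 2 * real k)) \<omega> \<ge> (1 - e) * sqrt (2 * (1 - 4 * e) * r 0 * (real k * ln 2))"
        by auto
      define u where "u = real j * exp (e * ln 2 * real k)"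
      define w where "w = 2 * (real k * ln 2)"
      have "1 * exp (e * ln 2 * real k) \<le> u" unfolding u_def using j by (intro mult_right_mono) auto
      moreover have "1 \<le> exp (e * ln 2 * real k)" using e by simp
      ultimately have uK: "u \<ge> K" and u1: "u \<ge> 1"
        using k by linarith+
      have "real j \<le> 2 ^ k" using of_nat_mono[OF j(2), where 'a = real] by simp
      then have "u \<le> 2 ^ k * exp (e * ln 2 * real k)"
        unfolding u_def by (rule mult_right_mono) simp
      then have "ln u \<le> ln (2 ^ k * exp (e * ln 2 * real k))"
        using u1 by (intro ln_mono) auto
      also have "\<dots> = (1 + e) * (real k * ln 2)"
        by (simp add: ln_mult ln_realpow algebra_simps)
      finally have lnu: "2 * ln u \<le> (1 + e) * w" by (simp add: w_def)
      have "Y u \<omega> < (\<sigma> - \<epsilon>) * sqrt (2 * ln u)" by (rule K[OF uK])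
      also have "\<dots> \<le> ((1 - 6 * e) * \<sigma>) * sqrt (2 * ln u)"
        using u1 by (intro mult_right_mono e\<epsilon>) simp
      also have "\<dots> \<le> ((1 - 6 * e) * \<sigma>) * sqrt ((1 + e) * w)"
        using lnu e \<sigma> by (intro mult_left_mono real_sqrt_le_mono) auto
      also have "\<dots> = ((1 - 6 * e) * sqrt (1 + e)) * (\<sigma> * sqrt w)"
        by (simp add: real_sqrt_mult)
      also have "\<dots> \<le> ((1 - e) * sqrt (1 - 4 * e)) * (\<sigma> * sqrt w)"
        using \<sigma> by (intro mult_right_mono key) (auto simp: w_def)
      also have "\<dots> = (1 - e) * sqrt (2 * (1 - 4 * e) * r 0 * (real k * ln 2))"
      proof -
        have "2 * (1 - 4 * e) * r 0 * (real k * ln 2) = (1 - 4 * e) * (r 0 * w)" by (simp add: w_def)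
        then show ?thesis unfolding \<sigma>_def by (simp only: real_sqrt_mult mult.assoc)
      qed
      also have "\<dots> \<le> Y u \<omega>" using ge by (simp only: u_def)
      finally show False by simp
    qed
  qed
qed

end

section \<open>The law of the iterated logarithm\<close>

lemma Limsup_ereal_eqI:
  fixes f :: "real \<Rightarrow> real"
  assumes upper: "\<And>e. e > 0 \<Longrightarrow> eventually (\<lambda>u. f u \<le> \<sigma> + e) F"
    and lower: "\<And>e. e > 0 \<Longrightarrow> frequently (\<lambda>u. f u \<ge> \<sigma> - e) F"
  shows "Limsup F (\<lambda>u. ereal (f u)) = ereal \<sigma>"
proof (rule antisym)
  show "Limsup F (\<lambda>u. ereal (f u)) \<le> ereal \<sigma>"
  proof (rule ereal_le_epsilon2)
    fix e :: real assume "0 < e"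
    then have "eventually (\<lambda>u. ereal (f u) \<le> ereal \<sigma> + ereal e) F" using upper by simp
    then show "Limsup F (\<lambda>u. ereal (f u)) \<le> ereal \<sigma> + ereal e" by (rule Limsup_bounded)
  qed
  show "ereal \<sigma> \<le> Limsup F (\<lambda>u. ereal (f u))"
  proof (rule ccontr)
    assume "\<not> ereal \<sigma> \<le> Limsup F (\<lambda>u. ereal (f u))"
    then obtain c where c: "Limsup F (\<lambda>u. ereal (f u)) < ereal c" "ereal c < ereal \<sigma>"
      using ereal_dense2[of "Limsup F (\<lambda>u. ereal (f u))" "ereal \<sigma>"] by (auto simp: not_le)
    have "eventually (\<lambda>u. \<not> f u \<ge> \<sigma> - (\<sigma> - c)) F"
      using Limsup_lessD[OF c(1)] by (rule eventually_mono) simp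
    then show False
      using lower[of "\<sigma> - c"] c(2) by (simp add: frequently_def)
  qed
qed

context stationary_gaussian
begin

lemma law_of_iterated_logarithm:
  assumes \<eta>: "\<eta> > 0" and decay: "r \<in> O[at_top](\<lambda>u. u powr (-\<eta>))"
  shows "AE \<omega> in M. Limsup at_top (\<lambda>u. ereal (Y u \<omega> / sqrt (2 * ln u))) = ereal (sqrt (r 0))"
proof -
  \<comment> \<open>Taking inverses of positive integers for \<open>\<epsilon>\<close> leaves only
    countably many null sets to unite.\<close>
  have "AE \<omega> in M. \<forall>n::nat. eventually (\<lambda>u. Y u \<omega> \<le> (sqrt (r 0) + inverse (Suc n)) * sqrt (2 * ln u)) at_top"
    using upper_bound by (simp add: AE_all_countable)
  moreover have "AE \<omega> in M. \<forall>n::nat. frequently (\<lambda>u. Y u \<omega> \<ge> (sqrt (r 0) - inverse (Suc n)) * sqrt (2 * ln u)) at_top"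
    using lower_bound[OF \<eta> decay] by (simp add: AE_all_countable)
  ultimately show ?thesis
  proof eventually_elim
    case (elim \<omega>)
    have pos: "eventually (\<lambda>u::real. sqrt (2 * ln u) > 0) at_top"
      using eventually_gt_at_top[of 1] by eventually_elim simp
    show ?case
    proof (rule Limsup_ereal_eqI)
      fix e :: real assume "e > 0"
      then obtain n where n: "inverse (real (Suc n)) < e" using reals_Archimedean by blast
      show "eventually (\<lambda>u. Y u \<omega> / sqrt (2 * ln u) \<le> sqrt (r 0) + e) at_top"
        using pos elim(1)[rule_format, of n]
      proof eventually_elim
        case (elim u)
        then have "Y u \<omega> / sqrt (2 * ln u) \<le> sqrt (r 0) + inverse (Suc n)" by (subst pos_divide_le_eq)
        then show ?case using n by linarith
      qed
      have "frequently (\<lambda>u. sqrt (2 * ln u) > 0 \<and> Y u \<omega> \<ge> (sqrt (r 0) - inverse (Suc n)) * sqrt (2 * ln u)) at_top"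
        using frequently_eventually_conj[OF elim(2)[rule_format, of n] pos] .
      then show "frequently (\<lambda>u. Y u \<omega> / sqrt (2 * ln u) \<ge> sqrt (r 0) - e) at_top"
      proof (rule frequently_elim1)
        fix u assume u: "sqrt (2 * ln u) > 0 \<and> Y u \<omega> \<ge> (sqrt (r 0) - inverse (Suc n)) * sqrt (2 * ln u)"
        then have "sqrt (r 0) - inverse (Suc n) \<le> Y u \<omega> / sqrt (2 * ln u)" by (subst pos_le_divide_eq) auto
        then show "sqrt (r 0) - e \<le> Y u \<omega> / sqrt (2 * ln u)" using n by linarith
      qed
    qed
  qed
qed

end

text \<open>One sign only: the other follows by applying this to \<open>- X\<close>, which has the
  same covariance \<open>R\<close>.\<close>

lemma self_similar_law_of_iterated_logarithm:
  fixes M :: "'a measure" and X :: "real \<Rightarrow> 'a \<Rightarrow> real"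
    and R :: "real \<Rightarrow> real \<Rightarrow> real" and \<rho> \<eta> :: real
  assumes gauss: "centered_gaussian_process M X"
    and paths: "\<forall>\<omega>\<in>space M. continuous_on {0..} (\<lambda>s. X s \<omega>)"
    and cov: "\<forall>s\<ge>0. \<forall>t\<ge>0. R s t = integral\<^sup>L M (\<lambda>\<omega>. X s \<omega> * X t \<omega>)"
    and selfsim: "\<forall>c>0. \<forall>s>0. \<forall>t>0. R (c * s) (c * t) = c powr (2 * \<rho>) * R s t"
    and eta_pos: "\<eta> > 0"
    and decay: "(\<lambda>x. x powr (- \<rho>) * R 1 x) \<in> O[at_top](\<lambda>x. (ln x) powr (- \<eta>))"
  shows "AE \<omega> in M. Limsup at_top (\<lambda>s. ereal (X s \<omega> / sqrt (2 * s powr (2 * \<rho>) * ln (ln s)))) = ereal (sqrt (R 1 1))"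
proof -
  define Y where "Y u \<omega> = exp (- \<rho> * u) * X (exp u) \<omega>" for u \<omega>
  define r where "r u = exp (- \<rho> * u) * R 1 (exp u)" for u
  have M: "prob_space M" and fam: "gaussian_family M {0..} X"
    using gauss by (auto simp: centered_gaussian_process_def gaussian_family_def)
  interpret prob_space M by (rule M)
  have ordered: "expectation (\<lambda>\<omega>. Y u \<omega> * Y v \<omega>) = r (v - u)" for u v
  proof -
    have "expectation (\<lambda>\<omega>. Y u \<omega> * Y v \<omega>) = expectation (\<lambda>\<omega>. (exp (- \<rho> * u) * exp (- \<rho> * v)) * (X (exp u) \<omega> * X (exp v) \<omega>))"
      by (simp add: Y_def mult_ac)
    also have "\<dots> = (exp (- \<rho> * u) * exp (- \<rho> * v)) * R (exp u) (exp v)"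
      using cov by simp
    also have "R (exp u) (exp v) = exp u powr (2 * \<rho>) * R 1 (exp (v - u))"
      using selfsim[rule_format, of "exp u" 1 "exp (v - u)"] by (simp flip: exp_add)
    also have "(exp (- \<rho> * u) * exp (- \<rho> * v)) * (exp u powr (2 * \<rho>) * R 1 (exp (v - u))) =
      (exp (- \<rho> * u) * exp (- \<rho> * v) * exp (2 * \<rho> * u)) * R 1 (exp (v - u))"
      by (simp add: powr_def)
    also have "exp (- \<rho> * u) * exp (- \<rho> * v) * exp (2 * \<rho> * u) = exp (- \<rho> * (v - u))"
      by (simp only: exp_add[symmetric]) (simp add: algebra_simps)
    finally show ?thesis by (simp add: r_def)
  qed
  interpret stationary_gaussian M Y r
  proof
    show "gaussian_family M UNIV Y"
      unfolding gaussian_family_def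
    proof (intro allI impI)
      fix J :: "real set" and c :: "real \<Rightarrow> real" assume "finite J"
      then have "centered_gaussian_rv M (\<lambda>\<omega>. \<Sum>t\<in>J. (c t * exp (- \<rho> * t)) * X (exp t) \<omega>)"
        by (intro gaussian_family_reindex[OF fam, where f = exp]) auto
      then show "centered_gaussian_rv M (\<lambda>\<omega>. \<Sum>t\<in>J. c t * Y t \<omega>)"
        by (simp add: Y_def mult.assoc)
    qed
    show "continuous_on UNIV (\<lambda>u. Y u \<omega>)" if "\<omega> \<in> space M" for \<omega>
      unfolding Y_def
    proof (rule continuous_on_mult)
      show "continuous_on UNIV (\<lambda>u. X (exp u) \<omega>)"
      proof (rule continuous_on_compose2[of "{0..}" "\<lambda>s. X s \<omega>" UNIV exp])
        show "continuous_on {0..} (\<lambda>s. X s \<omega>)" using that paths by blast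
        show "continuous_on UNIV (exp :: real \<Rightarrow> real)" by (intro continuous_intros)
      qed auto
    qed (intro continuous_intros)
    \<comment> \<open>\<open>ordered\<close> holds for lags of either sign; exchanging the two
      factors selects the nonnegative one.\<close>
    show "expectation (\<lambda>\<omega>. Y u \<omega> * Y v \<omega>) = r \<bar>u - v\<bar>" for u v
      using ordered[of u v] ordered[of v u] by (cases "u \<le> v") (simp_all add: mult.commute)
  qed
  \<comment> \<open>Substituting \<open>x = exp u\<close> turns decay in \<open>ln x\<close> into
    power decay in \<open>u\<close>.\<close>
  have "(\<lambda>u. exp u powr (- \<rho>) * R 1 (exp u)) \<in> O[at_top](\<lambda>u. (ln (exp u)) powr (- \<eta>))"
    by (rule landau_o.big.compose[OF decay exp_at_top])
  then have "r \<in> O[at_top](\<lambda>u. u powr (- \<eta>))"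
    by (simp add: r_def[abs_def] powr_def)
  from law_of_iterated_logarithm[OF eta_pos this]
  show ?thesis
  proof eventually_elim
    case (elim \<omega>)
    define g where "g s = ereal (X s \<omega> / sqrt (2 * s powr (2 * \<rho>) * ln (ln s)))" for s
    have g: "g (exp u) = ereal (Y u \<omega> / sqrt (2 * ln u))" for u
    proof -
      have "2 * exp u powr (2 * \<rho>) * ln (ln (exp u)) = (exp (\<rho> * u))\<^sup>2 * (2 * ln u)"
        by (simp add: powr_def power2_eq_square flip: exp_add)
      moreover have "sqrt ((exp (\<rho> * u))\<^sup>2 * (2 * ln u)) = exp (\<rho> * u) * sqrt (2 * ln u)"
        unfolding real_sqrt_mult[of "(exp (\<rho> * u))\<^sup>2"] by simp
      ultimately have "sqrt (2 * exp u powr (2 * \<rho>) * ln (ln (exp u))) = exp (\<rho> * u) * sqrt (2 * ln u)"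
        by (simp only:)
      then show ?thesis
        unfolding g_def Y_def by (simp only:) (simp add: exp_minus field_simps)
    qed
    \<comment> \<open>Since \<open>exp\<close> has the eventual inverse \<open>ln\<close> and both
      tend to infinity, the time change does not alter the limit superior.\<close>
    have "filtermap exp at_top = (at_top :: real filter)"
      by (rule filtermap_fun_inverse[OF ln_at_top exp_at_top])
        (use eventually_gt_at_top[of "0::real"] in \<open>auto elim: eventually_mono\<close>)
    then have "Limsup at_top g = Limsup (filtermap exp at_top) g" by simp
    also have "\<dots> = Limsup at_top (\<lambda>u. g (exp u))"
      by (rule Limsup_filtermap_eq) (simp add: inj_on_def)
    finally show ?case
      using elim by (simp add: g g_def[symmetric] r_def)
  qed
qed

theorem theorem1p2:
  fixes M :: "'a measure" and X :: "real \<Rightarrow> 'a \<Rightarrow> real"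
    and R :: "real \<Rightarrow> real \<Rightarrow> real" and \<rho> \<eta> :: real
  assumes gauss: "centered_gaussian_process M X"
    and paths: "\<forall>\<omega>\<in>space M. continuous_on {0..} (\<lambda>s. X s \<omega>)"
    and cov: "\<forall>s\<ge>0. \<forall>t\<ge>0. R s t = integral\<^sup>L M (\<lambda>\<omega>. X s \<omega> * X t \<omega>)"
    and rho_pos: "\<rho> > 0"
    and selfsim: "\<forall>c>0. \<forall>s>0. \<forall>t>0. R (c * s) (c * t) = c powr (2 * \<rho>) * R s t"
    and eta_pos: "\<eta> > 0"
    and decay: "(\<lambda>x. x powr (- \<rho>) * R 1 x) \<in> O[at_top](\<lambda>x. (ln x) powr (- \<eta>))"
  shows "(AE \<omega> in M. Limsup at_top (\<lambda>s. ereal (X s \<omega> / sqrt (2 * s powr (2 * \<rho>) * ln (ln s))))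
                    = ereal (sqrt (R 1 1))) \<and>
         (AE \<omega> in M. Limsup at_top (\<lambda>s. ereal (- X s \<omega> / sqrt (2 * s powr (2 * \<rho>) * ln (ln s))))
                    = ereal (sqrt (R 1 1)))"
proof
  show "AE \<omega> in M. Limsup at_top (\<lambda>s. ereal (X s \<omega> / sqrt (2 * s powr (2 * \<rho>) * ln (ln s)))) = ereal (sqrt (R 1 1))"
    by (rule self_similar_law_of_iterated_logarithm[OF gauss paths cov selfsim eta_pos decay])
  have "centered_gaussian_process M (\<lambda>s \<omega>. - X s \<omega>)"
    unfolding centered_gaussian_process_def
  proof (intro conjI allI impI)
    show "prob_space M" using gauss by (simp add: centered_gaussian_process_def)
    fix I :: "real set" and c :: "real \<Rightarrow> real" assume "finite I" "I \<subseteq> {0..}"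
    then have "centered_gaussian_rv M (\<lambda>\<omega>. \<Sum>t\<in>I. (- c t) * X t \<omega>)"
      using gauss[unfolded centered_gaussian_process_def, THEN conjunct2, rule_format, of I "\<lambda>t. - c t"] by simp
    then show "centered_gaussian_rv M (\<lambda>\<omega>. \<Sum>t\<in>I. c t * - X t \<omega>)" by simp
  qed
  moreover have "\<forall>\<omega>\<in>space M. continuous_on {0..} (\<lambda>s. - X s \<omega>)"
    using paths by (auto intro: continuous_on_minus)
  moreover have "\<forall>s\<ge>0. \<forall>t\<ge>0. R s t = integral\<^sup>L M (\<lambda>\<omega>. (- X s \<omega>) * (- X t \<omega>))"
    using cov by simp
  ultimately show "AE \<omega> in M. Limsup at_top (\<lambda>s. ereal (- X s \<omega> / sqrt (2 * s powr (2 * \<rho>) * ln (ln s)))) = ereal (sqrt (R 1 1))"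
    using selfsim eta_pos decay by (rule self_similar_law_of_iterated_logarithm[where X = "\<lambda>s \<omega>. - X s \<omega>"])
qed

end
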